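(* Let $p>3$ be a prime, let $V(\mathbb F_p)$ be the space of binary quartic forms over $\mathbb F_p$, and let $\Phi_p\colon V(\mathbb F_p)\to\{0,1\}$ be the characteristic function of singular binary quartic forms, i.e. $\Phi_p(h)=1$ if and only if $\mathrm{Disc}(h)=0$. For $f\in V(\mathbb F_p)$ put $$\widehat{\Phi_p}(f)=p^{-5}\sum_{h\in V(\mathbb F_p)}\Phi_p(h)\,e^{2\pi i[h,f]/p}.$$ Then $$\widehat{\Phi_p}(f)=\begin{cases} p^{-1}+p^{-2}-p^{-3} & \text{if } f=0,\\ p^{-2}-p^{-3} & \text{if } f \text{ has splitting type } (1^4) \text{ or } (1^31),\\ \chi_{12}(p)(-p^{-3}+p^{-4}) & \text{if } f \text{ has splitting type } (1^21^2),\\ \chi_{12}(p)(p^{-3}+p^{-4}) & \text{if } f \text{ has splitting type } (2^2),\\ \chi_{12}(p)\,p^{-4} & \text{if } f \text{ has splitting type } (1^211) \text{ or } (1^22),\\ \left(\frac{-3I(f)}{p}\right)p^{-4} & \text{if } J(f)=0,\ I(f)\neq 0,\\ a(E_f')\,p^{-4} & \text{if } J(f)\neq 0,\ \mathrm{Disc}(f)\neq 0, \end{cases}$$ where $E'_f$ is the elliptic curve over $\mathbb F_p$ defined by $y^2=x^3-3I(f)x^2+J(f)^2$ and $a(E'_f):=p+1-\#E'_f(\mathbb F_p)$.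
   Context: For a ring $R$, $V(R)$ is the set of binary quartic forms $f(x,y)=a_0x^4+a_1x^3y+a_2x^2y^2+a_3xy^3+a_4y^4$ with $a_i\in R$. The invariants are $I(f)=12a_0a_4-3a_1a_3+a_2^2$, $J(f)=72a_0a_2a_4+9a_1a_2a_3-27(a_0a_3^2+a_1^2a_4)-2a_2^3$, and $\mathrm{Disc}(f)=(4I(f)^3-J(f)^2)/27$. The bilinear form on $V(\mathbb F_p)$ ($p>3$), identifying $V$ with its dual, is $[f,h]=a_0b_0+\frac{a_1b_1}{4}+\frac{a_2b_2}{6}+\frac{a_3b_3}{4}+a_4b_4$, for $f$ with coefficients $a_i$ and $h$ with coefficients $b_i$. A nonzero $f\in V(\mathbb F_p)$ has splitting type $(d_1^{e_1}\cdots d_r^{e_r})$ if over $\mathbb F_p$ it has $r$ distinct (non-proportional) irreducible factors, the $i$-th being of degree $d_i$ and occurring with multiplicity $e_i$. $\left(\frac{\cdot}{p}\right)$ is the Legendre symbol. $\chi_{12}$ is the primitive Dirichlet character modulo $12$: $\chi_{12}(p)=1$ if $p\equiv\pm1\pmod{12}$ and $\chi_{12}(p)=-1$ if $p\equiv\pm5\pmod{12}$. $\#E'_f(\mathbb F_p)$ counts the point at infinity. *)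

theory Defs
  imports
    "HOL-Number_Theory.Residues"
    "Berlekamp_Zassenhaus.Finite_Field"
begin

text \<open>
  The prime field with \<open>p\<close> elements is \<^typ>\<open>'p::prime_card mod_ring\<close>, where
  \<open>p = CARD('p)\<close>; the class \<^class>\<open>prime_card\<close> says precisely that \<open>CARD('p)\<close> is prime.

  The bivariate polynomial ring \<open>R[x,y]\<close> is \<^typ>\<open>'a poly poly\<close>, read as \<open>R[x][y]\<close>: the
  coefficient of \<open>x\<^sup>j y\<^sup>i\<close> in \<open>f\<close> is \<open>coeff (coeff f i) j\<close>, and \<open>smult [:c:] f\<close> is the scalar
  multiple \<open>c f\<close>.
\<close>

definition binary_form :: "nat \<Rightarrow> 'a::comm_ring_1 poly poly \<Rightarrow> bool" where
  "binary_form d f \<longleftrightarrow> (\<forall>i j. coeff (coeff f i) j \<noteq> 0 \<longrightarrow> i + j = d)"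

definition V :: "'a::comm_ring_1 poly poly set" where
  "V = {f. binary_form 4 f}"

text \<open>The coefficient \<open>a\<^sub>i\<close> of \<open>x\<^sup>4\<^sup>-\<^sup>i y\<^sup>i\<close>, used for \<open>i \<le> 4\<close>.\<close>

definition qcoeff :: "'a::comm_ring_1 poly poly \<Rightarrow> nat \<Rightarrow> 'a" where
  "qcoeff f i = coeff (coeff f i) (4 - i)"

definition I_inv :: "'a::comm_ring_1 poly poly \<Rightarrow> 'a" where
  "I_inv f = 12 * qcoeff f 0 * qcoeff f 4 - 3 * qcoeff f 1 * qcoeff f 3 + (qcoeff f 2)^2"

definition J_inv :: "'a::comm_ring_1 poly poly \<Rightarrow> 'a" where
  "J_inv f = 72 * qcoeff f 0 * qcoeff f 2 * qcoeff f 4 + 9 * qcoeff f 1 * qcoeff f 2 * qcoeff f 3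
     - 27 * (qcoeff f 0 * (qcoeff f 3)^2 + (qcoeff f 1)^2 * qcoeff f 4) - 2 * (qcoeff f 2)^3"

definition Disc :: "'a::field poly poly \<Rightarrow> 'a" where
  "Disc f = (4 * (I_inv f)^3 - (J_inv f)^2) / 27"

definition pairing :: "'a::field poly poly \<Rightarrow> 'a poly poly \<Rightarrow> 'a" where
  "pairing f h = qcoeff f 0 * qcoeff h 0 + qcoeff f 1 * qcoeff h 1 / 4
     + qcoeff f 2 * qcoeff h 2 / 6 + qcoeff f 3 * qcoeff h 3 / 4 + qcoeff f 4 * qcoeff h 4"

text \<open>
  A splitting type \<open>(d\<^sub>1\<^sup>e\<^sup>1 \<dots> d\<^sub>r\<^sup>e\<^sup>r)\<close> is given by the list of the pairs \<open>(d\<^sub>i, e\<^sub>i)\<close>. The leading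
  constant \<open>c\<close> cannot be dropped: \<open>c\<close> times the square of an irreducible quadratic form has
  type \<open>(2\<^sup>2)\<close> also when \<open>c\<close> is not a square.
\<close>

definition proportional :: "'a::field poly poly \<Rightarrow> 'a poly poly \<Rightarrow> bool" where
  "proportional g h \<longleftrightarrow> (\<exists>u. u \<noteq> 0 \<and> g = smult [:u:] h)"

definition has_splitting_type :: "'a::field poly poly \<Rightarrow> (nat \<times> nat) list \<Rightarrow> bool" where
  "has_splitting_type f t \<longleftrightarrow> (\<exists>c gs. c \<noteq> 0 \<and> length gs = length t \<and>
     (\<forall>i < length t. binary_form (fst (t ! i)) (gs ! i) \<and> irreducible (gs ! i)) \<and>
     (\<forall>i < length t. \<forall>j < length t. i \<noteq> j \<longrightarrow> \<not> proportional (gs ! i) (gs ! j)) \<and>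
     f = smult [:c:] (\<Prod>i < length t. (gs ! i) ^ snd (t ! i)))"

definition Phi :: "'a::field poly poly \<Rightarrow> complex" where
  "Phi h = (if Disc h = 0 then 1 else 0)"

definition add_char :: "'p::prime_card mod_ring \<Rightarrow> complex" where
  "add_char x = exp (2 * complex_of_real pi * \<i> * of_int (to_int_mod_ring x) / of_nat CARD('p))"

definition Phi_hat :: "'p::prime_card mod_ring poly poly \<Rightarrow> complex" where
  "Phi_hat f = (\<Sum>h\<in>V. Phi h * add_char (pairing h f)) / of_nat CARD('p) ^ 5"

definition legendre_symbol :: "'p::prime_card mod_ring \<Rightarrow> int" where
  "legendre_symbol x = Legendre (to_int_mod_ring x) (int CARD('p))"

definition chi12 :: "nat \<Rightarrow> int" where
  "chi12 n = (if n mod 12 \<in> {1, 11} then 1 else if n mod 12 \<in> {5, 7} then - 1 else 0)"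

text \<open>The rational points of \<open>E'\<^sub>f\<close>; \<^const>\<open>None\<close> is the point at infinity.\<close>

definition E'_points :: "'a::field poly poly \<Rightarrow> ('a \<times> 'a) option set" where
  "E'_points f =
     insert None (Some ` {(x, y). y^2 = x^3 - 3 * I_inv f * x^2 + (J_inv f)^2})"

definition a_E' :: "'p::prime_card mod_ring poly poly \<Rightarrow> int" where
  "a_E' f = int CARD('p) + 1 - int (card (E'_points f))"

text \<open>Away from characteristic 2 and 3, \<open>E'\<^sub>f\<close> is nonsingular if \<open>J(f) Disc(f) \<noteq> 0\<close>.\<close>

lemma E'_nonsingular:
  fixes f :: "'a::field poly poly"
  assumes char: "(2::'a) \<noteq> 0" "(3::'a) \<noteq> 0"
    and J: "J_inv f \<noteq> 0" and D: "Disc f \<noteq> 0"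
    and pt: "y^2 = x^3 - 3 * I_inv f * x^2 + (J_inv f)^2"
  shows "2 * y \<noteq> 0 \<or> 3 * x^2 - 6 * I_inv f * x \<noteq> 0"
proof (rule ccontr)
  assume "\<not> ?thesis"
  then have y: "y = 0" and "3 * (x * (x - 2 * I_inv f)) = 0"
    using char by (auto simp: algebra_simps power2_eq_square)
  then consider "x = 0" | "x = 2 * I_inv f" using char by auto
  then show False
  proof cases
    case 1
    then show False using pt y J by simp
  next
    case 2
    with pt y have "4 * (I_inv f)^3 - (J_inv f)^2 = 0"
      by (simp add: power2_eq_square power3_eq_cube algebra_simps)
    with D show False by (simp add: Disc_def)
  qed
qed

end

theory Submission
  imports Defs "HOL-Number_Theory.Quadratic_Reciprocity"
begin

text \<open>
  Let \<open>\<chi>\<close> be the quadratic character of the field with \<open>p\<close> elements. Two observations reduce the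
  theorem to elementary character sums.

  \<^emph>\<open>Singular forms.\<close> A nonzero form of discriminant zero has exactly one rational double root,
  except when it is \<open>c Q\<^sup>2\<close> for a quadratic form \<open>Q\<close> with \<open>disc Q \<noteq> 0\<close>; then its double roots are
  the rational roots of \<open>Q\<close>, and there are \<open>1 + \<chi>(disc Q)\<close> of them. Such a form has exactly \<open>p - 1\<close>
  representations \<open>c Q\<^sup>2\<close>, so for every \<open>h\<close>

    \<open>\<Phi>(h) = #{double roots of h} - (p - 1)\<^sup>-\<^sup>1 \<Sum> {\<chi>(disc Q) | c Q\<^sup>2 = h} - p [h = 0]\<close>

  (\<open>singular_indicator\<close>). The forms with a double root at a given point are a linear space, whose
  annihilator consists of the forms divisible by the cube of one linear form. Hence the first
  term transforms into \<open>p\<^sup>-\<^sup>2\<close> times the number of linear forms \<open>l\<close>, up to scaling, with \<open>l\<^sup>3\<close>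
  dividing \<open>f\<close>. In the second term, \<open>[Q\<^sup>2, f]\<close> is a quadratic form \<open>A(Q)\<close> in the three coefficients
  of \<open>Q\<close>, and summing over \<open>c\<close> leaves the sum \<open>S(f)\<close> of \<open>\<chi>(disc Q)\<close> over the \<open>Q\<close> with \<open>A(Q) = 0\<close>.
  Altogether (\<open>fourier_singular\<close>)

    \<open>p\<^sup>4 Phi_hat f = p\<^sup>2 #{l | l\<^sup>3 divides f} - S(f) / (p - 1)\<close>.

  \<^emph>\<open>The sum over the conic.\<close> For fixed \<open>Q\<close>, the sum of \<open>\<chi>(disc Q - w A(Q))\<close> over all \<open>w\<close> is \<open>p \<chi>(disc Q)\<close> if
  \<open>A(Q) = 0\<close> and \<open>0\<close> otherwise. So \<open>p S(f)\<close> is the sum, over the members \<open>M\<close> of the pencil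
  \<open>disc - w A\<close>, of \<open>\<Sum>\<^sub>v \<chi>(M v)\<close>. For a nonzero ternary quadratic form \<open>M\<close> this inner sum is
  \<open>p (p - 1) \<chi>(- det M)\<close> unless \<open>M\<close> has rank one (\<open>ternary_sum_cases\<close>). With \<open>A\<close> multiplied by 12,
  \<open>- det M = 4 (1 - 3 I w\<^sup>2 + J w\<^sup>3)\<close>, and a member of rank one exists only if \<open>f = c Q\<^sup>2\<close> with
  \<open>disc Q \<noteq> 0\<close>, in which case there is exactly one. Therefore

    \<open>S(f) / (p - 1) = \<Sum>\<^sub>w \<chi>(1 - 3 I w\<^sup>2 + J w\<^sup>3)\<close>,

  with an additional \<open>p \<chi>(3 disc Q)\<close> when \<open>f = c Q\<^sup>2\<close> with \<open>c disc Q \<noteq> 0\<close>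
  (\<open>apolar_sum_non_square\<close>, \<open>apolar_sum_square\<close>).

  The cubic sum is evaluated case by case. If \<open>J \<noteq> 0\<close>, the substitution \<open>x = J w\<close> turns it into the
  point count of \<open>E'\<^sub>f\<close>. If \<open>J = 0\<close>, it is a sum over a quadratic polynomial. If \<open>Disc f = 0\<close> and
  \<open>I \<noteq> 0\<close>, the cubic has a double root and the sum is \<open>- \<chi>(3)\<close>, which is \<open>- \<chi>\<^sub>1\<^sub>2(p)\<close> by quadratic
  reciprocity. If \<open>I = J = 0\<close>, it is \<open>p\<close>.
\<close>

section \<open>Sums of the quadratic character in one variable\<close>

definition qchar :: "'a::field \<Rightarrow> int" where
  "qchar x = (if x = 0 then 0 else if \<exists>y. x = y^2 then 1 else - 1)"

lemma qchar_0 [simp]: "qchar 0 = 0"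
  and qchar_1 [simp]: "qchar 1 = 1"
  by (auto simp: qchar_def intro: exI[of _ 1])

lemma qchar_square: "y \<noteq> 0 \<Longrightarrow> qchar (y^2) = 1"
  by (auto simp: qchar_def)

lemma qchar_mult_square:
  fixes x y :: "'a::field"
  assumes "y \<noteq> 0"
  shows "qchar (y^2 * x) = qchar x"
proof -
  have "(\<exists>z. y^2 * x = z^2) \<longleftrightarrow> (\<exists>z. x = z^2)"
  proof
    assume "\<exists>z. y^2 * x = z^2"
    then obtain z where "y^2 * x = z^2" by blast
    then have "x = (z / y)^2" using assms by (simp add: field_simps)
    then show "\<exists>z. x = z^2" by blast
  qed (metis power_mult_distrib)
  then show ?thesis using assms by (simp add: qchar_def)
qed

lemma card_square_roots:
  fixes x :: "'a::field"
  assumes "(2::'a) \<noteq> 0"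
  shows "int (card {y. y^2 = x}) = 1 + qchar x"
proof (cases "\<exists>z. x = z^2")
  case True
  then obtain z where z: "x = z^2" by blast
  have "{y. y^2 = x} = {z, - z}" by (auto simp: z power2_eq_iff)
  moreover have "z = - z \<longleftrightarrow> z = 0"
    using assms by (metis add_eq_0_iff mult_2 mult_eq_0_iff)
  ultimately show ?thesis using z by (auto simp: qchar_def)
next
  case False
  then have "{y. y^2 = x} = {}" by auto
  moreover have "x \<noteq> 0" using False by (metis power_zero_numeral)
  ultimately show ?thesis using False by (simp add: qchar_def)
qed

text \<open>
  The substitution \<open>v = u\<^sup>2\<close>: each \<open>v\<close> has
  \<open>1 + \<chi>(v)\<close> square roots.
\<close>
lemma sum_over_squares:
  fixes F :: "'a::{field,finite} \<Rightarrow> int"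
  assumes "(2::'a) \<noteq> 0"
  shows "(\<Sum>u\<in>UNIV. F (u^2)) = (\<Sum>v\<in>UNIV. (1 + qchar v) * F v)"
proof -
  have "(\<Sum>u\<in>UNIV. F (u^2)) = (\<Sum>v\<in>UNIV. \<Sum>u\<in>{u\<in>UNIV. u^2 = v}. F (u^2))"
    by (rule sum.group[symmetric]) auto
  also have "\<dots> = (\<Sum>v\<in>UNIV. (1 + qchar v) * F v)"
    by (rule sum.cong) (auto simp: card_square_roots[OF assms, symmetric])
  finally show ?thesis .
qed

lemma sum_affine:
  fixes F :: "'a::{field,finite} \<Rightarrow> 'b::comm_monoid_add"
  assumes "a \<noteq> 0"
  shows "(\<Sum>x\<in>UNIV. F (a * x + b)) = (\<Sum>x\<in>UNIV. F x)"
  by (rule sum.reindex_bij_witness[of _ "\<lambda>y. (y - b) / a" "\<lambda>x. a * x + b"])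
    (use assms in auto)

lemma sum_qchar:
  assumes "(2::'a::{field,finite}) \<noteq> 0"
  shows "(\<Sum>x\<in>UNIV. qchar (x::'a)) = 0"
  using sum_over_squares[OF assms, of "\<lambda>_. 1"] by (simp add: sum.distrib)

text \<open>
  Multiplicativity by counting: if \<open>y\<close> is not a square, then \<open>y x\<close> is a
  non-square for every nonzero square \<open>x\<close>; as there are as many squares as non-squares,
  multiplication by \<open>y\<close> has to exchange them.
\<close>
lemma qchar_mult:
  fixes x y :: "'a::{field,finite}"
  assumes two: "(2::'a) \<noteq> 0"
  shows "qchar (x * y) = qchar x * qchar y"
proof (cases "y = 0 \<or> (\<exists>z. y = z^2)")
  case True
  then show ?thesis
    by (metis mult.commute mult_1 mult_zero_right power_zero_numeral qchar_0 qchar_mult_square qchar_square)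
next
  case False
  then have y: "y \<noteq> 0" "qchar y = - 1" by (auto simp: qchar_def)
  \<comment> \<open>Every term of this vanishing sum is at most zero, hence equal to zero.\<close>
  have sum0: "(\<Sum>x\<in>UNIV. qchar (y * x) + qchar x) = 0"
    using sum_affine[OF y(1), of qchar 0] sum_qchar[OF two] by (simp add: sum.distrib)
  have "qchar (y * x) + qchar x \<le> 0" for x
  proof (cases "x \<noteq> 0 \<and> (\<exists>z. x = z^2)")
    case True
    then obtain z where "x = z^2" "z \<noteq> 0" by auto
    then show ?thesis using qchar_mult_square[of z y] y qchar_square[of z] by (simp add: mult.commute)
  next
    case False
    then show ?thesis by (auto simp: qchar_def)
  qed
  with sum0 have "qchar (y * x) + qchar x = 0"
    by (metis (mono_tags, lifting) UNIV_I finite neg_0_equal_iff_equal neg_0_le_iff_le sum_negf sum_nonneg_eq_0_iff)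
  then show ?thesis using y by (simp add: mult.commute)
qed

lemma sum_qchar_affine:
  assumes "(2::'a::{field,finite}) \<noteq> 0" "a \<noteq> 0"
  shows "(\<Sum>x\<in>UNIV. qchar (a * x + b :: 'a)) = 0"
  using sum_affine[OF assms(2), of qchar b] sum_qchar[OF assms(1)] by simp

text \<open>
  Averaging over a pencil detects the zeros of \<open>a\<close>. This is what replaces the condition
  \<open>A(Q) = 0\<close> by a sum over quadratic forms.
\<close>
lemma sum_qchar_pencil:
  fixes a b :: "'a::{field,finite}"
  assumes "(2::'a) \<noteq> 0"
  shows "(\<Sum>w\<in>UNIV. qchar (b - w * a)) = (if a = 0 then int CARD('a) * qchar b else 0)"
  using sum_qchar_affine[OF assms, of "- a" b] by (simp add: algebra_simps)

text \<open>
  For \<open>\<delta> \<noteq> 0\<close> the sum becomes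
  \<open>\<Sum>\<^sub>v \<chi>(v) \<chi>(v - \<delta>)\<close>, and
  \<open>\<chi>(v) \<chi>(v - \<delta>) = \<chi>(1 - \<delta>/v)\<close>, where
  \<open>1 - \<delta>/v\<close> runs over everything except \<open>1\<close>.
\<close>
lemma sum_qchar_square_minus:
  fixes \<delta> :: "'a::{field,finite}"
  assumes two: "(2::'a) \<noteq> 0"
  shows "(\<Sum>u\<in>UNIV. qchar (u^2 - \<delta>)) = (if \<delta> = 0 then int CARD('a) - 1 else - 1)"
proof (cases "\<delta> = 0")
  case True
  have "(\<Sum>u\<in>UNIV. qchar (u^2 - \<delta>)) = (\<Sum>u\<in>UNIV - {0::'a}. 1 :: int)"
    using True by (subst sum.remove[of _ 0]) (auto intro!: sum.cong simp: qchar_square)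
  then show ?thesis using True by (simp add: card_Diff_singleton of_nat_diff)
next
  case False
  have "(\<Sum>u\<in>UNIV. qchar (u^2 - \<delta>)) = (\<Sum>v\<in>UNIV. qchar (v - \<delta>)) + (\<Sum>v\<in>UNIV. qchar v * qchar (v - \<delta>))"
    by (subst sum_over_squares[OF two, of "\<lambda>v. qchar (v - \<delta>)"]) (simp add: sum.distrib algebra_simps)
  also have "(\<Sum>v\<in>UNIV. qchar (v - \<delta>)) = 0"
    using sum_qchar_affine[OF two, of 1 "- \<delta>"] by simp
  also have "(\<Sum>v\<in>UNIV. qchar v * qchar (v - \<delta>)) = (\<Sum>v\<in>UNIV - {0}. qchar (v * (v - \<delta>)))"
    by (subst sum.remove[of _ 0]) (auto simp: qchar_mult[OF two])
  also have "\<dots> = (\<Sum>w\<in>UNIV - {1::'a}. qchar w)"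
  proof (rule sum.reindex_bij_witness[of _ "\<lambda>w. \<delta> / (1 - w)" "\<lambda>v. 1 - \<delta> / v"])
    fix v :: 'a assume "v \<in> UNIV - {0}"
    then have "v * (v - \<delta>) = v^2 * (1 - \<delta> / v)" by (simp add: field_simps power2_eq_square)
    then show "qchar (1 - \<delta> / v) = qchar (v * (v - \<delta>))"
      using \<open>v \<in> UNIV - {0}\<close> by (simp add: qchar_mult_square)
  qed (use False in auto)
  also have "\<dots> = - 1"
    using sum_qchar[OF two] by (subst (asm) sum.remove[of _ 1]) auto
  finally show ?thesis using False by simp
qed

lemma sum_qchar_quadratic:
  fixes a b c :: "'a::{field,finite}"
  assumes two: "(2::'a) \<noteq> 0" and a: "a \<noteq> 0"
  shows "(\<Sum>x\<in>UNIV. qchar (a * x^2 + 2 * b * x + c)) =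
    qchar a * (if b^2 - a * c = 0 then int CARD('a) - 1 else - 1)"
proof -
  have eq: "a^2 * (a * x^2 + 2 * b * x + c) = a * ((a * x + b)^2 - (b^2 - a * c))" for x
    by (simp add: algebra_simps power2_eq_square)
  have "(\<Sum>x\<in>UNIV. qchar (a * x^2 + 2 * b * x + c)) =
      (\<Sum>x\<in>UNIV. qchar a * qchar ((a * x + b)^2 - (b^2 - a * c)))"
    by (rule sum.cong[OF refl], subst qchar_mult_square[OF a, symmetric], subst eq)
      (rule qchar_mult[OF two])
  then show ?thesis
    using sum_affine[OF a, of "\<lambda>u. qchar (u^2 - (b^2 - a * c))" b] sum_qchar_square_minus[OF two]
    by (simp add: sum_distrib_left[symmetric])
qed

section \<open>Sums of the quadratic character over a ternary quadratic form\<close>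

lemma sum_qchar_multiple_squares:
  fixes a :: "'a::{field,finite}"
  shows "(\<Sum>z\<in>UNIV. qchar (z^2 * a)) = (int CARD('a) - 1) * qchar a"
proof -
  have "(\<Sum>z\<in>UNIV. qchar (z^2 * a)) = (\<Sum>z\<in>UNIV - {0::'a}. qchar a)"
    by (subst sum.remove[of _ 0]) (auto intro!: sum.cong simp: qchar_mult_square)
  then show ?thesis by (simp add: card_Diff_singleton of_nat_diff algebra_simps)
qed

lemma sum_indicator: "(\<Sum>x\<in>UNIV. if P x then 1 else 0 :: int) = int (card {x::'a::finite. P x})"
  by (simp add: sum.If_cases)

text \<open>
  A binary quadratic form of discriminant \<open>\<delta>\<close> vanishes on
  \<open>1 + \<chi>(\<delta>)\<close> lines through the origin, also in the degenerate case
  \<open>\<delta> = 0\<close> of a double line.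
\<close>
lemma count_binary_zeros:
  fixes a b c :: "'a::{field,finite}"
  assumes two: "(2::'a) \<noteq> 0" and nz: "a \<noteq> 0 \<or> b \<noteq> 0 \<or> c \<noteq> 0"
  shows "(\<Sum>z\<in>UNIV. \<Sum>y\<in>UNIV. if a * y^2 + 2 * b * y * z + c * z^2 = 0 then 1 else 0 :: int)
    = int CARD('a) + (int CARD('a) - 1) * qchar (b^2 - a * c)"
proof (cases "a = 0")
  case False
  have "(\<Sum>y\<in>UNIV. if a * y^2 + 2 * b * y * z + c * z^2 = 0 then 1 else 0 :: int)
      = 1 + qchar (z^2 * (b^2 - a * c))" for z
  proof -
    have eq: "a * (a * y^2 + 2 * b * y * z + c * z^2) = (a * y + b * z)^2 - z^2 * (b^2 - a * c)" for y
      by (simp add: algebra_simps power2_eq_square)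
    have "a * y^2 + 2 * b * y * z + c * z^2 = 0 \<longleftrightarrow> (a * y + b * z)^2 = z^2 * (b^2 - a * c)" for y
      using eq[of y] False by (metis eq_iff_diff_eq_0 mult_eq_0_iff)
    then have "(\<Sum>y\<in>UNIV. if a * y^2 + 2 * b * y * z + c * z^2 = 0 then 1 else 0 :: int)
        = (\<Sum>u\<in>UNIV. if u^2 = z^2 * (b^2 - a * c) then 1 else 0)"
      using sum_affine[OF False, of "\<lambda>u. if u^2 = z^2 * (b^2 - a * c) then 1 else 0 :: int" "b * z"]
        by simp
    then show ?thesis by (simp only: sum_indicator card_square_roots[OF two])
  qed
  then show ?thesis by (simp add: sum.distrib sum_qchar_multiple_squares)
next
  case True
  have "(\<Sum>y\<in>UNIV. if a * y^2 + 2 * b * y * z + c * z^2 = 0 then 1 else 0 :: int)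
      = (if z = 0 then int CARD('a) else if b = 0 then 0 else 1)" for z
  proof (cases "z = 0 \<or> b = 0")
    case True
    then show ?thesis using \<open>a = 0\<close> nz by auto
  next
    case False
    have "2 * b * y * z + c * z^2 = 0 \<longleftrightarrow> y = - (c * z) / (2 * b)" for y
    proof -
      have "2 * b * y * z + c * z^2 = z * (y * (2 * b) + c * z)"
        by (simp add: algebra_simps power2_eq_square)
      moreover have "2 * b \<noteq> 0" using two False by simp
      ultimately show ?thesis using False
        by (subst nonzero_eq_divide_eq) (simp_all only: eq_neg_iff_add_eq_0 mult_eq_0_iff simp_thms, blast)
    qed
    then show ?thesis using \<open>a = 0\<close> False by simp
  qed
  then have "(\<Sum>z\<in>UNIV. \<Sum>y\<in>UNIV. if a * y^2 + 2 * b * y * z + c * z^2 = 0 then 1 else 0 :: int)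
      = (\<Sum>z\<in>UNIV. if z = (0::'a) then int CARD('a) else if b = 0 then 0 else 1)"
    by simp
  also have "\<dots> = int CARD('a) + (\<Sum>z\<in>UNIV-{0::'a}. if b = 0 then 0 else 1)"
    by (subst sum.remove[of _ 0]) (auto intro!: sum.cong)
  finally show ?thesis using True
    by (cases "b = 0") (auto simp: qchar_square card_Diff_singleton of_nat_diff)
qed

text \<open>
  The Gram matrix has rows \<open>(a, b, c)\<close>, \<open>(b, d, e)\<close>,
  \<open>(c, e, f)\<close>.
\<close>
definition ternary :: "'a::field \<Rightarrow> 'a \<Rightarrow> 'a \<Rightarrow> 'a \<Rightarrow> 'a \<Rightarrow> 'a \<Rightarrow> 'a \<Rightarrow> 'a \<Rightarrow> 'a \<Rightarrow> 'a" where
  "ternary a b c d e f x y z = a * x^2 + 2 * b * x * y + 2 * c * x * z + d * y^2 + 2 * e * y * z + f * z^2"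

definition ternary_det :: "'a::field \<Rightarrow> 'a \<Rightarrow> 'a \<Rightarrow> 'a \<Rightarrow> 'a \<Rightarrow> 'a \<Rightarrow> 'a" where
  "ternary_det a b c d e f = a * d * f + 2 * b * c * e - a * e^2 - d * c^2 - f * b^2"

definition ternary_sum :: "'a::{field,finite} \<Rightarrow> 'a \<Rightarrow> 'a \<Rightarrow> 'a \<Rightarrow> 'a \<Rightarrow> 'a \<Rightarrow> int" where
  "ternary_sum a b c d e f = (\<Sum>z\<in>UNIV. \<Sum>y\<in>UNIV. \<Sum>x\<in>UNIV. qchar (ternary a b c d e f x y z))"

lemma ternary_sum_swap_xy: "ternary_sum a b c d e f = ternary_sum d b e a c f"
  unfolding ternary_sum_def
  by (subst (2) sum.swap) (simp add: ternary_def algebra_simps)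

lemma sum_reverse3:
  fixes F :: "'b \<Rightarrow> 'c \<Rightarrow> 'd \<Rightarrow> 'e::comm_monoid_add"
  shows "(\<Sum>z\<in>A. \<Sum>y\<in>B. \<Sum>x\<in>C. F z y x) = (\<Sum>x\<in>C. \<Sum>y\<in>B. \<Sum>z\<in>A. F z y x)"
proof -
  have "(\<Sum>z\<in>A. \<Sum>y\<in>B. \<Sum>x\<in>C. F z y x) = (\<Sum>y\<in>B. \<Sum>z\<in>A. \<Sum>x\<in>C. F z y x)"
    by (rule sum.swap)
  also have "\<dots> = (\<Sum>y\<in>B. \<Sum>x\<in>C. \<Sum>z\<in>A. F z y x)"
    by (rule sum.cong[OF refl], rule sum.swap)
  also have "\<dots> = (\<Sum>x\<in>C. \<Sum>y\<in>B. \<Sum>z\<in>A. F z y x)"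
    by (rule sum.swap)
  finally show ?thesis .
qed

lemma ternary_sum_swap_xz: "ternary_sum a b c d e f = ternary_sum f e c d b a"
  unfolding ternary_sum_def
  by (subst sum_reverse3) (simp add: ternary_def algebra_simps)

text \<open>
  Summing over \<open>x\<close> first gives \<open>- \<chi>(a)\<close>, plus
  \<open>q \<chi>(a)\<close> where the discriminant in \<open>x\<close> vanishes; here
  \<open>q\<close> is the size of the field. This discriminant is a binary form in \<open>y\<close>
  and \<open>z\<close> whose own discriminant is \<open>- a det\<close> by Sylvester's identity, so
  its zeros are counted by \<open>count_binary_zeros\<close>. The assumption on the minors says that
  the Gram matrix has rank at least two.
\<close>
lemma ternary_sum_corner:
  fixes a b c d e f :: "'a::{field,finite}"
  assumes two: "(2::'a) \<noteq> 0" and a: "a \<noteq> 0"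
    and nz: "b^2 - a * d \<noteq> 0 \<or> b * c - a * e \<noteq> 0 \<or> c^2 - a * f \<noteq> 0"
  shows "ternary_sum a b c d e f =
    int CARD('a) * (int CARD('a) - 1) * qchar (- ternary_det a b c d e f)"
proof -
  let ?A = "b^2 - a * d" and ?B = "b * c - a * e" and ?C = "c^2 - a * f"
  let ?q = "int CARD('a)"
  have inner: "(\<Sum>x\<in>UNIV. qchar (ternary a b c d e f x y z)) =
      qchar a * (?q * (if ?A * y^2 + 2 * ?B * y * z + ?C * z^2 = 0 then 1 else 0) - 1)" for y z
  proof -
    have "(\<Sum>x\<in>UNIV. qchar (ternary a b c d e f x y z)) =
        (\<Sum>x\<in>UNIV. qchar (a * x^2 + 2 * (b * y + c * z) * x + (d * y^2 + 2 * e * y * z + f * z^2)))"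
      by (simp add: ternary_def algebra_simps)
    moreover have "(b * y + c * z)^2 - a * (d * y^2 + 2 * e * y * z + f * z^2)
        = ?A * y^2 + 2 * ?B * y * z + ?C * z^2"
      by (simp add: algebra_simps power2_eq_square)
    ultimately show ?thesis by (simp only: sum_qchar_quadratic[OF two a]) simp
  qed
  have "ternary_sum a b c d e f = qchar a * (?q *
      (\<Sum>z\<in>UNIV. \<Sum>y\<in>UNIV. if ?A * y^2 + 2 * ?B * y * z + ?C * z^2 = 0 then 1 else 0) - ?q^2)"
    unfolding ternary_sum_def inner
    by (simp add: sum_distrib_left[symmetric] sum_subtractf power2_eq_square)
  also have "\<dots> = ?q * (?q - 1) * (qchar a * qchar (?B^2 - ?A * ?C))"
    by (simp only: count_binary_zeros[OF two nz]) (simp add: algebra_simps power2_eq_square)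
  also have "qchar a * qchar (?B^2 - ?A * ?C) = qchar (a * (?B^2 - ?A * ?C))"
    by (simp only: qchar_mult[OF two])
  also have "a * (?B^2 - ?A * ?C) = a^2 * - ternary_det a b c d e f"
    by (simp add: ternary_det_def algebra_simps power2_eq_square)
  finally show ?thesis by (simp only: qchar_mult_square[OF a])
qed

text \<open>
  For \<open>a = 0\<close> the form is linear in \<open>x\<close>, so only the line
  \<open>b y + c z = 0\<close> contributes to the sum over \<open>x\<close>. On that line the
  form is a square times its value at \<open>(c, - b)\<close>, which is \<open>- det\<close>.
\<close>
lemma ternary_sum_hyperbolic:
  fixes b c d e f :: "'a::{field,finite}"
  assumes two: "(2::'a) \<noteq> 0" and bc: "b \<noteq> 0 \<or> c \<noteq> 0"
  shows "ternary_sum 0 b c d e f =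
    int CARD('a) * (int CARD('a) - 1) * qchar (- ternary_det 0 b c d e f)"
proof -
  let ?q = "int CARD('a)"
  let ?N = "\<lambda>y z. d * y^2 + 2 * e * y * z + f * z^2"
  have inner: "(\<Sum>x\<in>UNIV. qchar (ternary 0 b c d e f x y z)) =
      (if b * y + c * z = 0 then ?q * qchar (?N y z) else 0)" for y z
  proof -
    have "(\<Sum>x\<in>UNIV. qchar (ternary 0 b c d e f x y z)) =
        (\<Sum>x\<in>UNIV. qchar (?N y z - x * (- 2 * (b * y + c * z))))"
      by (simp add: ternary_def algebra_simps)
    moreover have "- 2 * (b * y + c * z) = 0 \<longleftrightarrow> b * y + c * z = 0"
      using two by (simp only: mult_eq_0_iff neg_equal_0_iff_equal simp_thms)
    ultimately show ?thesis by (simp only: sum_qchar_pencil[OF two])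
  qed
  have "ternary_sum 0 b c d e f = ?q * (\<Sum>z\<in>UNIV. \<Sum>y\<in>UNIV. if b * y + c * z = 0 then qchar (?N y z) else 0)"
    unfolding ternary_sum_def inner by (simp add: sum_distrib_left if_distrib cong: if_cong)
  also have "(\<Sum>z\<in>UNIV. \<Sum>y\<in>UNIV. if b * y + c * z = 0 then qchar (?N y z) else 0)
      = (\<Sum>w\<in>UNIV. qchar (w^2 * ?N c (- b)))"
  proof (cases "c = 0")
    case True
    then have "b * y + c * z = 0 \<longleftrightarrow> y = 0" for y z using bc by simp
    then have "(\<Sum>z\<in>UNIV. \<Sum>y\<in>UNIV. if b * y + c * z = 0 then qchar (?N y z) else 0)
        = (\<Sum>z\<in>UNIV. qchar (?N 0 z))" by simp
    also have "\<dots> = (\<Sum>w\<in>UNIV. qchar (w^2 * ?N c (- b)))"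
      using sum_affine[of "- b" "\<lambda>z. qchar (?N 0 z)" 0] True bc
      by (simp add: algebra_simps power2_eq_square)
    finally show ?thesis .
  next
    case False
    have "(\<Sum>z\<in>UNIV. \<Sum>y\<in>UNIV. if b * y + c * z = 0 then qchar (?N y z) else 0)
        = (\<Sum>y\<in>UNIV. \<Sum>z\<in>UNIV. if b * y + c * z = 0 then qchar (?N y z) else 0)"
      by (rule sum.swap)
    also have "b * y + c * z = 0 \<longleftrightarrow> z = - b * y / c" for y z
      using False by (auto simp: field_simps add_eq_0_iff)
    then have "(\<Sum>y\<in>UNIV. \<Sum>z\<in>UNIV. if b * y + c * z = 0 then qchar (?N y z) else 0)
        = (\<Sum>y\<in>UNIV. qchar (?N y (- b * y / c)))" by simp
    also have "\<dots> = (\<Sum>w\<in>UNIV. qchar (?N (c * w) (- b * w)))"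
      using sum_affine[OF False, of "\<lambda>y. qchar (?N y (- b * y / c))" 0] False by simp
    finally show ?thesis by (simp add: algebra_simps power2_eq_square)
  qed
  also have "\<dots> = (?q - 1) * qchar (- ternary_det 0 b c d e f)"
    by (subst sum_qchar_multiple_squares) (simp add: ternary_det_def algebra_simps power2_eq_square)
  finally show ?thesis by simp
qed

text \<open>
  A form of rank two is covered by the first alternative: its sum vanishes together with its
  determinant. If the diagonal entry \<open>a\<close> and the entries next to it vanish, permuting the
  coordinates leads back to the preceding lemmas.
\<close>
lemma ternary_sum_cases:
  fixes a b c d e f :: "'a::{field,finite}"
  assumes two: "(2::'a) \<noteq> 0"
    and nz: "a \<noteq> 0 \<or> b \<noteq> 0 \<or> c \<noteq> 0 \<or> d \<noteq> 0 \<or> e \<noteq> 0 \<or> f \<noteq> 0"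
  obtains "ternary_sum a b c d e f =
      int CARD('a) * (int CARD('a) - 1) * qchar (- ternary_det a b c d e f)"
  | k l m n where "k \<noteq> 0" "a = k * l^2" "b = k * l * m" "c = k * l * n"
      "d = k * m^2" "e = k * m * n" "f = k * n^2"
proof -
  let ?q = "int CARD('a)"
  define generic where "generic a b c d e f \<longleftrightarrow>
    ternary_sum a b c d e f = ?q * (?q - 1) * qchar (- ternary_det a b c d e f)" for a b c d e f :: 'a
  define rank1 where "rank1 a b c d e f \<longleftrightarrow> (\<exists>k l m n. k \<noteq> 0 \<and> a = k * l^2 \<and> b = k * l * m \<and>
    c = k * l * n \<and> d = k * m^2 \<and> e = k * m * n \<and> f = k * n^2)" for a b c d e f :: 'a
  have corner: "generic a b c d e f \<or> rank1 a b c d e f" if "a \<noteq> 0" for a b c d e f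
  proof (cases "b^2 - a * d = 0 \<and> b * c - a * e = 0 \<and> c^2 - a * f = 0")
    case True
    then have "rank1 a b c d e f" unfolding rank1_def
      by (intro exI[of _ "1 / a"] exI[of _ a] exI[of _ b] exI[of _ c])
        (use that in \<open>simp add: field_simps power2_eq_square\<close>)
    then show ?thesis ..
  next
    case False
    then show ?thesis using ternary_sum_corner[OF two that] by (simp add: generic_def)
  qed
  have swap_xy: "generic d b e a c f \<or> rank1 d b e a c f \<Longrightarrow> generic a b c d e f \<or> rank1 a b c d e f"
    for a b c d e f
  proof (elim disjE)
    assume "generic d b e a c f"
    moreover have "ternary_det d b e a c f = ternary_det a b c d e f"
      by (simp add: ternary_det_def algebra_simps)
    ultimately have "generic a b c d e f"
      by (simp add: generic_def ternary_sum_swap_xy[of a])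
    then show ?thesis ..
  next
    assume "rank1 d b e a c f"
    then obtain k l m n where "k \<noteq> 0" "d = k * l^2" "b = k * l * m" "e = k * l * n"
      "a = k * m^2" "c = k * m * n" "f = k * n^2" unfolding rank1_def by blast
    then have "rank1 a b c d e f" unfolding rank1_def
      by (intro exI[of _ k] exI[of _ m] exI[of _ l] exI[of _ n]) (simp add: mult_ac)
    then show ?thesis ..
  qed
  have swap_xz: "generic f e c d b a \<or> rank1 f e c d b a \<Longrightarrow> generic a b c d e f \<or> rank1 a b c d e f"
    for a b c d e f
  proof (elim disjE)
    assume "generic f e c d b a"
    moreover have "ternary_det f e c d b a = ternary_det a b c d e f"
      by (simp add: ternary_det_def algebra_simps)
    ultimately have "generic a b c d e f"
      by (simp add: generic_def ternary_sum_swap_xz[of a])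
    then show ?thesis ..
  next
    assume "rank1 f e c d b a"
    then obtain k l m n where "k \<noteq> 0" "f = k * l^2" "e = k * l * m" "c = k * l * n"
      "d = k * m^2" "b = k * m * n" "a = k * n^2" unfolding rank1_def by blast
    then have "rank1 a b c d e f" unfolding rank1_def
      by (intro exI[of _ k] exI[of _ n] exI[of _ m] exI[of _ l]) (simp add: mult_ac)
    then show ?thesis ..
  qed
  have "generic a b c d e f \<or> rank1 a b c d e f"
  proof -
    consider "a \<noteq> 0" | "a = 0" "b \<noteq> 0 \<or> c \<noteq> 0" | "a = 0" "b = 0" "c = 0" "d \<noteq> 0"
      | "a = 0" "b = 0" "c = 0" "d = 0" "e \<noteq> 0" | "a = 0" "b = 0" "c = 0" "f \<noteq> 0"
      using nz by blast
    then show ?thesis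
    proof cases
      case 1
      then show ?thesis by (rule corner)
    next
      case 2
      then show ?thesis using ternary_sum_hyperbolic[OF two] by (simp add: generic_def)
    next
      case 3
      then show ?thesis using corner[OF 3(4), of b e a c f] swap_xy by blast
    next
      case 4
      then show ?thesis using ternary_sum_hyperbolic[OF two, of 0 e a c f]
        unfolding generic_def ternary_sum_swap_xy[of a]
        by (simp add: ternary_det_def)
    next
      case 5
      then show ?thesis using corner[OF 5(4), of e c d b a] swap_xz by blast
    qed
  qed
  then show thesis using that unfolding generic_def rank1_def by blast
qed

lemma sum_linear:
  fixes F :: "'a::{field,finite} \<Rightarrow> int"
  assumes "l \<noteq> 0 \<or> m \<noteq> 0 \<or> n \<noteq> 0"
  shows "(\<Sum>z\<in>UNIV. \<Sum>y\<in>UNIV. \<Sum>x\<in>UNIV. F (l * x + m * y + n * z)) = int CARD('a)^2 * (\<Sum>u\<in>UNIV. F u)"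
proof -
  have one: "(\<Sum>x\<in>UNIV. F (l * x + t)) = (\<Sum>u\<in>UNIV. F u)" if "l \<noteq> 0" for l t
    by (rule sum_affine[OF that])
  consider "l \<noteq> 0" | "l = 0" "m \<noteq> 0" | "l = 0" "m = 0" "n \<noteq> 0" using assms by blast
  then show ?thesis
  proof cases
    case 1
    then show ?thesis by (simp add: one add.assoc power2_eq_square)
  next
    case 2
    have "(\<Sum>z\<in>UNIV. \<Sum>y\<in>UNIV. \<Sum>x\<in>(UNIV::'a set). F (l * x + m * y + n * z)) = int CARD('a) * (\<Sum>z\<in>UNIV. \<Sum>y\<in>UNIV. F (m * y + n * z))"
      using 2 by (simp add: sum_distrib_left)
    then show ?thesis using 2 by (simp add: one power2_eq_square)
  next
    case 3
    have "(\<Sum>z\<in>UNIV. \<Sum>y\<in>(UNIV::'a set). \<Sum>x\<in>(UNIV::'a set). F (l * x + m * y + n * z)) = int CARD('a)^2 * (\<Sum>z\<in>UNIV. F (n * z + 0))"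
      using 3 by (simp add: sum_distrib_left power2_eq_square mult.assoc)
    then show ?thesis by (simp only: one[OF 3(3)])
  qed
qed

lemma ternary_sum_rank1:
  fixes k l m n :: "'a::{field,finite}"
  assumes two: "(2::'a) \<noteq> 0" and nz: "l \<noteq> 0 \<or> m \<noteq> 0 \<or> n \<noteq> 0"
  shows "ternary_sum (k * l^2) (k * l * m) (k * l * n) (k * m^2) (k * m * n) (k * n^2)
    = int CARD('a)^2 * (int CARD('a) - 1) * qchar k"
proof -
  have "ternary (k * l^2) (k * l * m) (k * l * n) (k * m^2) (k * m * n) (k * n^2) x y z
      = (l * x + m * y + n * z)^2 * k" for x y z
    by (simp add: ternary_def algebra_simps power2_eq_square)
  then have "ternary_sum (k * l^2) (k * l * m) (k * l * n) (k * m^2) (k * m * n) (k * n^2)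
      = int CARD('a)^2 * (\<Sum>u\<in>UNIV. qchar (u^2 * k))"
    using sum_linear[OF nz, of "\<lambda>u. qchar (u^2 * k)"] by (simp add: ternary_sum_def)
  then show ?thesis by (simp add: sum_qchar_multiple_squares)
qed

section \<open>The conic attached to a quartic and its pencil\<close>

text \<open>
  This says \<open>f = c Q\<^sup>2\<close> for
  \<open>Q = \<alpha> x\<^sup>2 + \<beta> x y + \<gamma> y\<^sup>2\<close>, as far as the
  coefficients used for forms in \<open>V\<close> are concerned.
\<close>
definition square_multiple :: "'a::field poly poly \<Rightarrow> 'a \<Rightarrow> 'a \<Rightarrow> 'a \<Rightarrow> 'a \<Rightarrow> bool" where
  "square_multiple f c \<alpha> \<beta> \<gamma> \<longleftrightarrow> qcoeff f 0 = c * \<alpha>^2 \<and> qcoeff f 1 = c * (2 * \<alpha> * \<beta>) \<and>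
     qcoeff f 2 = c * (\<beta>^2 + 2 * \<alpha> * \<gamma>) \<and> qcoeff f 3 = c * (2 * \<beta> * \<gamma>) \<and> qcoeff f 4 = c * \<gamma>^2"

text \<open>
  This is \<open>12 [Q\<^sup>2, f]\<close> for
  \<open>Q = \<alpha> x\<^sup>2 + \<beta> x y + \<gamma> y\<^sup>2\<close>; the factor
  clears the denominators of the bilinear form. It is written \<open>A(Q)\<close> in the comments
  below.
\<close>
definition catalecticant :: "'a::field poly poly \<Rightarrow> 'a \<Rightarrow> 'a \<Rightarrow> 'a \<Rightarrow> 'a" where
  "catalecticant f \<alpha> \<beta> \<gamma> = 12 * qcoeff f 0 * \<alpha>^2 + 6 * qcoeff f 1 * \<alpha> * \<beta>
     + 2 * qcoeff f 2 * (\<beta>^2 + 2 * \<alpha> * \<gamma>) + 6 * qcoeff f 3 * \<beta> * \<gamma> + 12 * qcoeff f 4 * \<gamma>^2"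

text \<open>The sum \<open>S(f)\<close> of the introduction.\<close>
definition apolar_sum :: "'a::{field,finite} poly poly \<Rightarrow> int" where
  "apolar_sum f = (\<Sum>\<gamma>\<in>UNIV. \<Sum>\<beta>\<in>UNIV. \<Sum>\<alpha>\<in>UNIV.
     if catalecticant f \<alpha> \<beta> \<gamma> = 0 then qchar (\<beta>^2 - 4 * \<alpha> * \<gamma>) else 0)"

definition resolvent :: "'a::field poly poly \<Rightarrow> 'a \<Rightarrow> 'a" where
  "resolvent f w = 1 - 3 * I_inv f * w^2 + J_inv f * w^3"

text \<open>
  The character sum over the ternary form
  \<open>(\<alpha>, \<beta>, \<gamma>) \<mapsto> \<beta>\<^sup>2 - 4 \<alpha> \<gamma> - w A(\<alpha>, \<beta>, \<gamma>)\<close>.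
\<close>
definition pencil_sum :: "'a::{field,finite} poly poly \<Rightarrow> 'a \<Rightarrow> int" where
  "pencil_sum f w = ternary_sum (- 12 * w * qcoeff f 0) (- 3 * w * qcoeff f 1) (- 2 - 2 * w * qcoeff f 2)
     (1 - 2 * w * qcoeff f 2) (- 3 * w * qcoeff f 3) (- 12 * w * qcoeff f 4)"

lemma sum_swap_to_inner:
  fixes F :: "'b \<Rightarrow> 'c \<Rightarrow> 'd \<Rightarrow> 'e \<Rightarrow> 'f::comm_monoid_add"
  shows "(\<Sum>w\<in>A. \<Sum>z\<in>B. \<Sum>y\<in>C. \<Sum>x\<in>D. F w z y x) = (\<Sum>z\<in>B. \<Sum>y\<in>C. \<Sum>x\<in>D. \<Sum>w\<in>A. F w z y x)"
proof -
  have "(\<Sum>w\<in>A. \<Sum>z\<in>B. \<Sum>y\<in>C. \<Sum>x\<in>D. F w z y x) = (\<Sum>z\<in>B. \<Sum>w\<in>A. \<Sum>y\<in>C. \<Sum>x\<in>D. F w z y x)"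
    by (rule sum.swap)
  also have "\<dots> = (\<Sum>z\<in>B. \<Sum>y\<in>C. \<Sum>w\<in>A. \<Sum>x\<in>D. F w z y x)"
    by (rule sum.cong[OF refl], rule sum.swap)
  also have "\<dots> = (\<Sum>z\<in>B. \<Sum>y\<in>C. \<Sum>x\<in>D. \<Sum>w\<in>A. F w z y x)"
    by (rule sum.cong[OF refl], rule sum.cong[OF refl], rule sum.swap)
  finally show ?thesis .
qed

lemma apolar_sum_eq_pencil_sums:
  fixes f :: "'a::{field,finite} poly poly"
  assumes two: "(2::'a) \<noteq> 0"
  shows "int CARD('a) * apolar_sum f = (\<Sum>w\<in>UNIV. pencil_sum f w)"
proof -
  have "(\<Sum>w\<in>UNIV. pencil_sum f w) = (\<Sum>w\<in>UNIV. \<Sum>\<gamma>\<in>UNIV. \<Sum>\<beta>\<in>UNIV. \<Sum>\<alpha>\<in>UNIV.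
      qchar (\<beta>^2 - 4 * \<alpha> * \<gamma> - w * catalecticant f \<alpha> \<beta> \<gamma>))"
    by (simp add: pencil_sum_def ternary_sum_def ternary_def catalecticant_def algebra_simps)
  also have "\<dots> = (\<Sum>\<gamma>\<in>UNIV. \<Sum>\<beta>\<in>UNIV. \<Sum>\<alpha>\<in>UNIV. \<Sum>w\<in>UNIV.
      qchar (\<beta>^2 - 4 * \<alpha> * \<gamma> - w * catalecticant f \<alpha> \<beta> \<gamma>))"
    by (rule sum_swap_to_inner)
  also have "\<dots> = int CARD('a) * apolar_sum f"
    by (simp add: sum_qchar_pencil[OF two] apolar_sum_def sum_distrib_left if_distrib cong: if_cong)
  finally show ?thesis by simp
qed

lemma I_inv_square_multiple:
  "square_multiple f c \<alpha> \<beta> \<gamma> \<Longrightarrow> I_inv f = c^2 * (\<beta>^2 - 4 * \<alpha> * \<gamma>)^2"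
  by (simp add: square_multiple_def I_inv_def power2_eq_square algebra_simps)

lemma J_inv_square_multiple:
  "square_multiple f c \<alpha> \<beta> \<gamma> \<Longrightarrow> J_inv f = - 2 * c^3 * (\<beta>^2 - 4 * \<alpha> * \<gamma>)^3"
  by (simp add: square_multiple_def J_inv_def power2_eq_square power3_eq_cube algebra_simps)

text \<open>
  The term linear in \<open>w\<close> is absent because the discriminant form is apolar to every
  \<open>A\<close>. The remaining coefficients are the invariants of \<open>f\<close>, up to the
  scaling that makes them \<open>1\<close>, \<open>- 3 I\<close> and \<open>J\<close>.
\<close>
lemma pencil_det:
  "- ternary_det (- 12 * w * qcoeff f 0) (- 3 * w * qcoeff f 1) (- 2 - 2 * w * qcoeff f 2)
     (1 - 2 * w * qcoeff f 2) (- 3 * w * qcoeff f 3) (- 12 * w * qcoeff f 4) = 2^2 * resolvent f w"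
  by (simp add: ternary_det_def resolvent_def I_inv_def J_inv_def power2_eq_square power3_eq_cube algebra_simps)

lemma numerals_neq_zero:
  assumes "(2::'a::field) \<noteq> 0" "(3::'a) \<noteq> 0"
  shows "(4::'a) \<noteq> 0" "(6::'a) \<noteq> 0" "(12::'a) \<noteq> 0"
proof -
  have "(4::'a) = 2 * 2" "(6::'a) = 2 * 3" "(12::'a) = 2 * 2 * 3" by simp_all
  with assms show "(4::'a) \<noteq> 0" "(6::'a) \<noteq> 0" "(12::'a) \<noteq> 0"
    by (metis mult_eq_0_iff)+
qed

text \<open>
  If \<open>disc - w A = k (l \<alpha> + m \<beta> + n \<gamma>)\<^sup>2\<close>, then
  comparing the entries of the two sides at \<open>\<alpha> \<gamma>\<close> and
  \<open>\<beta>\<^sup>2\<close>, which the coefficient \<open>a\<^sub>2\<close> of \<open>f\<close>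
  enters equally, gives \<open>k (m\<^sup>2 - l n) = 3\<close>. The other entries then say that
  \<open>f\<close> is a multiple of the square of
  \<open>l x\<^sup>2 + 2 m x y + n y\<^sup>2\<close>.
\<close>
lemma pencil_sum_cases:
  fixes f :: "'a::{field,finite} poly poly"
  assumes two: "(2::'a) \<noteq> 0" and three: "(3::'a) \<noteq> 0"
  obtains "pencil_sum f w = int CARD('a) * (int CARD('a) - 1) * qchar (resolvent f w)"
  | c \<alpha> \<beta> \<gamma> where "square_multiple f c \<alpha> \<beta> \<gamma>" "w * c * (\<beta>^2 - 4 * \<alpha> * \<gamma>) = - 1"
proof -
  let ?a = "- 12 * w * qcoeff f 0" and ?b = "- 3 * w * qcoeff f 1" and ?c = "- 2 - 2 * w * qcoeff f 2"
    and ?d = "1 - 2 * w * qcoeff f 2" and ?e = "- 3 * w * qcoeff f 3" and ?f = "- 12 * w * qcoeff f 4"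
  \<comment> \<open>No member of the pencil is the zero form.\<close>
  have "?d - ?c = 3" by simp
  then have nz: "?a \<noteq> 0 \<or> ?b \<noteq> 0 \<or> ?c \<noteq> 0 \<or> ?d \<noteq> 0 \<or> ?e \<noteq> 0 \<or> ?f \<noteq> 0"
    using three by (metis diff_0_right)
  show thesis
  proof (cases rule: ternary_sum_cases[OF two nz])
    case 1
    then show ?thesis
      using that(1) unfolding pencil_sum_def pencil_det by (simp only: qchar_mult_square[OF two])
  next
    case (2 k l m n)
    have disc: "k * (m^2 - l * n) = 3"
    proof -
      have "k * (m^2 - l * n) = k * m^2 - k * l * n" by (simp add: algebra_simps)
      also have "\<dots> = ?d - ?c" by (simp only: 2)
      finally show ?thesis by simp
    qed
    have w: "w \<noteq> 0"
    proof
      assume "w = 0"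
      then have "l = 0" "k * l * n = - 2" using 2 by auto
      then show False using two by simp
    qed
    note [simp] = numerals_neq_zero[OF two three] two three
    define c where "c = - k / (12 * w)"
    have k: "k = - 12 * w * c" using w by (simp add: c_def)
    have "3 * (4 * w * c * (l * n - m^2)) = 3 * 1"
      using disc by (simp add: k algebra_simps)
    then have wc: "4 * w * c * (l * n - m^2) = 1"
      by (simp only: mult_cancel_left three simp_thms)
    have "square_multiple f c l (2 * m) n"
    proof -
      have eqs: "12 * w * (qcoeff f 0 - c * l^2) = 0" "3 * w * (qcoeff f 1 - c * (2 * l * (2 * m))) = 0"
        "2 * w * (qcoeff f 2 - c * ((2 * m)^2 + 2 * l * n)) = 0"
        "3 * w * (qcoeff f 3 - c * (2 * (2 * m) * n)) = 0" "12 * w * (qcoeff f 4 - c * n^2) = 0"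
        subgoal using 2(2) by (simp add: k algebra_simps)
        subgoal using 2(3) by (simp add: k algebra_simps)
        subgoal
        proof -
          have "2 * w * (qcoeff f 2 - c * ((2 * m)^2 + 2 * l * n))
              = (k * m^2 - ?d) + (1 - 4 * w * c * (l * n - m^2))"
            by (simp add: k algebra_simps power2_eq_square)
          then show ?thesis by (simp only: 2(5) wc) simp
        qed
        subgoal using 2(6) by (simp add: k algebra_simps)
        subgoal using 2(7) by (simp add: k algebra_simps)
        done
      then show ?thesis using w by (simp add: square_multiple_def)
    qed
    moreover have "w * c * ((2 * m)^2 - 4 * l * n) = - 1"
    proof -
      have "w * c * ((2 * m)^2 - 4 * l * n) = - (4 * w * c * (l * n - m^2))"
        by (simp add: algebra_simps power2_eq_square)
      then show ?thesis by (simp only: wc)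
    qed
    ultimately show ?thesis by (rule that(2))
  qed
qed

text \<open>
  Conversely, for \<open>f = c Q\<^sup>2\<close> the member at
  \<open>w = - 1 / (c disc Q)\<close> is \<open>12 / disc Q\<close> times the square of a
  linear form.
\<close>
lemma pencil_sum_square_multiple:
  fixes f :: "'a::{field,finite} poly poly"
  assumes two: "(2::'a) \<noteq> 0" and three: "(3::'a) \<noteq> 0"
    and f: "square_multiple f c \<alpha> \<beta> \<gamma>" and w: "w * c * (\<beta>^2 - 4 * \<alpha> * \<gamma>) = - 1"
  shows "pencil_sum f w = int CARD('a)^2 * (int CARD('a) - 1) * qchar (3 * (\<beta>^2 - 4 * \<alpha> * \<gamma>))"
    and "resolvent f w = 0"
proof -
  let ?D = "\<beta>^2 - 4 * \<alpha> * \<gamma>"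
  define k where "k = - 12 * w * c"
  note [simp] = numerals_neq_zero[OF two three] two three
  have kD: "k * ?D = 12"
  proof -
    have "k * ?D = - 12 * (w * c * ?D)" by (simp add: k_def mult.assoc)
    then show ?thesis by (simp only: w) simp
  qed
  have D: "?D \<noteq> 0" using w by auto
  define m where "m = \<beta> / 2"
  have m: "\<beta> = 2 * m" by (simp add: m_def)
  have wD: "4 * w * c * (m^2 - \<alpha> * \<gamma>) = - 1"
    using w by (simp add: m power2_eq_square algebra_simps)
  have "pencil_sum f w = ternary_sum (k * \<alpha>^2) (k * \<alpha> * m) (k * \<alpha> * \<gamma>) (k * m^2) (k * m * \<gamma>) (k * \<gamma>^2)"
  proof -
    have "- 12 * w * qcoeff f 0 = k * \<alpha>^2" "- 3 * w * qcoeff f 1 = k * \<alpha> * m"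
      "- 2 - 2 * w * qcoeff f 2 = k * \<alpha> * \<gamma>" "1 - 2 * w * qcoeff f 2 = k * m^2"
      "- 3 * w * qcoeff f 3 = k * m * \<gamma>" "- 12 * w * qcoeff f 4 = k * \<gamma>^2"
    proof -
      have "- 2 - 2 * w * qcoeff f 2 - k * \<alpha> * \<gamma> = - 2 * (1 + 4 * w * c * (m^2 - \<alpha> * \<gamma>))"
        using f by (simp add: square_multiple_def k_def m algebra_simps power2_eq_square)
      then show "- 2 - 2 * w * qcoeff f 2 = k * \<alpha> * \<gamma>" by (simp only: wD) simp
      have "1 - 2 * w * qcoeff f 2 - k * m^2 = 1 + 4 * w * c * (m^2 - \<alpha> * \<gamma>)"
        using f by (simp add: square_multiple_def k_def m algebra_simps power2_eq_square)
      then show "1 - 2 * w * qcoeff f 2 = k * m^2" by (simp only: wD) simp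
    qed (use f in \<open>simp_all add: square_multiple_def k_def m algebra_simps power2_eq_square\<close>)
    then show ?thesis by (simp only: pencil_sum_def)
  qed
  also have "\<dots> = int CARD('a)^2 * (int CARD('a) - 1) * qchar k"
    using D by (intro ternary_sum_rank1) (auto simp: m)
  also have "qchar k = qchar (?D^2 * k)" using D by (simp add: qchar_mult_square)
  also have "?D^2 * k = ?D * (k * ?D)" by (simp only: power2_eq_square mult_ac)
  also have "\<dots> = 2^2 * (3 * ?D)" by (simp only: kD) simp
  also have "qchar \<dots> = qchar (3 * ?D)" by (rule qchar_mult_square[OF two])
  finally show "pencil_sum f w = int CARD('a)^2 * (int CARD('a) - 1) * qchar (3 * ?D)" .
  have "resolvent f w = 1 - 3 * (w * c * ?D)^2 - 2 * (w * c * ?D)^3"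
    using I_inv_square_multiple[OF f] J_inv_square_multiple[OF f]
    by (simp add: resolvent_def power_mult_distrib)
  then show "resolvent f w = 0" by (simp only: w) simp
qed

lemma apolar_sum_non_square:
  fixes f :: "'a::{field,finite} poly poly"
  assumes two: "(2::'a) \<noteq> 0" and three: "(3::'a) \<noteq> 0"
    and f: "\<And>c \<alpha> \<beta> \<gamma>. square_multiple f c \<alpha> \<beta> \<gamma> \<Longrightarrow> c * (\<beta>^2 - 4 * \<alpha> * \<gamma>) = 0"
  shows "apolar_sum f = (int CARD('a) - 1) * (\<Sum>w\<in>UNIV. qchar (resolvent f w))"
proof -
  have "pencil_sum f w = int CARD('a) * (int CARD('a) - 1) * qchar (resolvent f w)" for w
    by (cases rule: pencil_sum_cases[OF two three, of f w]) (use f in \<open>force simp: mult.assoc\<close>)+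
  then have "int CARD('a) * apolar_sum f = int CARD('a) * ((int CARD('a) - 1) * (\<Sum>w\<in>UNIV. qchar (resolvent f w)))"
    by (simp add: apolar_sum_eq_pencil_sums[OF two] sum_distrib_left mult.assoc)
  then show ?thesis by simp
qed

text \<open>
  The member of rank one is unique, since a parameter \<open>w\<close> with
  \<open>w c' disc Q' = - 1\<close> and \<open>f = c' Q'\<^sup>2\<close> satisfies
  \<open>J w = 2 I\<close>.
\<close>
lemma apolar_sum_square:
  fixes f :: "'a::{field,finite} poly poly"
  assumes two: "(2::'a) \<noteq> 0" and three: "(3::'a) \<noteq> 0"
    and f: "square_multiple f c \<alpha> \<beta> \<gamma>" and nz: "c * (\<beta>^2 - 4 * \<alpha> * \<gamma>) \<noteq> 0"
  shows "apolar_sum f = (int CARD('a) - 1) *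
    ((\<Sum>w\<in>UNIV. qchar (resolvent f w)) + int CARD('a) * qchar (3 * (\<beta>^2 - 4 * \<alpha> * \<gamma>)))"
proof -
  let ?q = "int CARD('a)" and ?D = "\<beta>^2 - 4 * \<alpha> * \<gamma>"
  \<comment> \<open>The parameter of the member of rank one.\<close>
  define w0 where "w0 = - 1 / (c * ?D)"
  have w0: "w0 * c * ?D = - 1" using nz by (simp add: w0_def)
  have generic: "pencil_sum f w = ?q * (?q - 1) * qchar (resolvent f w)" if "w \<noteq> w0" for w
  proof (cases rule: pencil_sum_cases[OF two three, of f w])
    case (2 c' \<alpha>' \<beta>' \<gamma>')
    let ?D' = "\<beta>'^2 - 4 * \<alpha>' * \<gamma>'"
    have "J_inv f * w = - 2 * (c' * ?D')^2 * (w * c' * ?D')"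
      using J_inv_square_multiple[OF 2(1)] by (simp add: power2_eq_square power3_eq_cube)
    also have "\<dots> = 2 * I_inv f"
      using I_inv_square_multiple[OF 2(1)] by (simp only: 2(2)) (simp add: power_mult_distrib)
    finally have Jw: "J_inv f * w = 2 * I_inv f" .
    have "2 * (c * ?D)^2 * (w * c * ?D) = - (J_inv f * w)"
      using J_inv_square_multiple[OF f] by (simp add: power2_eq_square power3_eq_cube)
    also have "\<dots> = - 2 * (c * ?D)^2"
      using I_inv_square_multiple[OF f] by (simp only: Jw) (simp add: power_mult_distrib)
    finally have "2 * (c * ?D)^2 * (w * c * ?D) = - 2 * (c * ?D)^2" .
    then have "2 * (c * ?D)^2 * (w * c * ?D) = 2 * (c * ?D)^2 * (w0 * c * ?D)"
      by (simp add: w0)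
    then have "w = w0" using nz two by simp
    with that show ?thesis by simp
  qed
  have "?q * apolar_sum f = pencil_sum f w0 + (\<Sum>w\<in>UNIV - {w0}. ?q * (?q - 1) * qchar (resolvent f w))"
    by (simp add: apolar_sum_eq_pencil_sums[OF two] sum.remove[of UNIV w0] generic)
  also have "(\<Sum>w\<in>UNIV - {w0}. ?q * (?q - 1) * qchar (resolvent f w))
      = ?q * (?q - 1) * (\<Sum>w\<in>UNIV. qchar (resolvent f w))"
    using pencil_sum_square_multiple(2)[OF two three f w0]
    by (simp add: sum.remove[of UNIV w0] sum_distrib_left)
  also have "pencil_sum f w0 = ?q^2 * (?q - 1) * qchar (3 * ?D)"
    by (rule pencil_sum_square_multiple(1)[OF two three f w0])
  finally have "?q * apolar_sum f = ?q * ((?q - 1) * ((\<Sum>w\<in>UNIV. qchar (resolvent f w)) + ?q * qchar (3 * ?D)))"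
    by (simp add: algebra_simps power2_eq_square)
  then show ?thesis by simp
qed

section \<open>Rational double roots of singular quartics\<close>

text \<open>A double root at \<open>(x : 1)\<close>.\<close>
definition double_root :: "'a::field poly poly \<Rightarrow> 'a \<Rightarrow> bool" where
  "double_root f x \<longleftrightarrow>
     qcoeff f 0 * x^4 + qcoeff f 1 * x^3 + qcoeff f 2 * x^2 + qcoeff f 3 * x + qcoeff f 4 = 0 \<and>
     4 * qcoeff f 0 * x^3 + 3 * qcoeff f 1 * x^2 + 2 * qcoeff f 2 * x + qcoeff f 3 = 0"

text \<open>A double root at \<open>(1 : 0)\<close>.\<close>
definition double_root_at_infinity :: "'a::field poly poly \<Rightarrow> bool" where
  "double_root_at_infinity f \<longleftrightarrow> qcoeff f 0 = 0 \<and> qcoeff f 1 = 0"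

lemma double_root_iff:
  "double_root f x \<longleftrightarrow>
     qcoeff f 3 = - (4 * qcoeff f 0 * x^3 + 3 * qcoeff f 1 * x^2 + 2 * qcoeff f 2 * x) \<and>
     qcoeff f 4 = 3 * qcoeff f 0 * x^4 + 2 * qcoeff f 1 * x^3 + qcoeff f 2 * x^2" (is "_ \<longleftrightarrow> ?R")
proof -
  let ?D = "4 * qcoeff f 0 * x^3 + 3 * qcoeff f 1 * x^2 + 2 * qcoeff f 2 * x + qcoeff f 3"
  let ?r = "3 * qcoeff f 0 * x^4 + 2 * qcoeff f 1 * x^3 + qcoeff f 2 * x^2"
  have "qcoeff f 0 * x^4 + qcoeff f 1 * x^3 + qcoeff f 2 * x^2 + qcoeff f 3 * x + qcoeff f 4
      = (qcoeff f 4 - ?r) + x * ?D"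
    by (simp add: algebra_simps power2_eq_square power3_eq_cube power4_eq_xxxx)
  then have "double_root f x \<longleftrightarrow> ?D = 0 \<and> qcoeff f 4 - ?r = 0"
    unfolding double_root_def by (metis add.right_neutral mult_zero_right)
  also have "?D = 0 \<longleftrightarrow> qcoeff f 3 = - (4 * qcoeff f 0 * x^3 + 3 * qcoeff f 1 * x^2 + 2 * qcoeff f 2 * x)"
    by (simp only: eq_neg_iff_add_eq_0 ac_simps)
  finally show ?thesis by simp
qed

lemma Disc_eq_0_iff:
  assumes "(3::'a::field) \<noteq> 0"
  shows "Disc (f :: 'a poly poly) = 0 \<longleftrightarrow> 4 * I_inv f ^ 3 = J_inv f ^ 2"
proof -
  have "(27::'a) = 3 * 3 * 3" by simp
  then have "(27::'a) \<noteq> 0" using assms by (metis mult_eq_0_iff)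
  then show ?thesis by (simp add: Disc_def)
qed

text \<open>
  The curve \<open>4 I\<^sup>3 = J\<^sup>2\<close> is parametrised by \<open>r\<close>; the sign is
  the one that occurs for \<open>f = (x - r\<^sub>0 y)\<^sup>2 q\<close> with
  \<open>r = q(r\<^sub>0, 1)\<close>.
\<close>
lemma Disc_eq_0_if_cusp_param:
  "I_inv f = r^2 \<Longrightarrow> J_inv f = - 2 * r^3 \<Longrightarrow> Disc f = 0"
  by (simp add: Disc_def power_mult_distrib flip: power_mult)

lemma Disc_double_root:
  assumes "double_root f x"
  shows "Disc f = 0"
proof (rule Disc_eq_0_if_cusp_param)
  let ?r = "6 * qcoeff f 0 * x^2 + 3 * qcoeff f 1 * x + qcoeff f 2"
  note eqs = assms[unfolded double_root_iff]
  show "I_inv f = ?r^2"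
    unfolding I_inv_def conjunct1[OF eqs] conjunct2[OF eqs]
    by (simp add: algebra_simps power2_eq_square power3_eq_cube power4_eq_xxxx)
  show "J_inv f = - 2 * ?r^3"
    unfolding J_inv_def conjunct1[OF eqs] conjunct2[OF eqs]
    by (simp add: algebra_simps power2_eq_square power3_eq_cube power4_eq_xxxx)
qed

lemma Disc_double_root_at_infinity: "double_root_at_infinity f \<Longrightarrow> Disc f = 0"
  by (rule Disc_eq_0_if_cusp_param[of _ "qcoeff f 2"])
    (simp_all add: double_root_at_infinity_def I_inv_def J_inv_def)

lemma Disc_square_multiple: "square_multiple f c \<alpha> \<beta> \<gamma> \<Longrightarrow> Disc f = 0"
  by (rule Disc_eq_0_if_cusp_param[of _ "c * (\<beta>^2 - 4 * \<alpha> * \<gamma>)"])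
    (simp_all add: I_inv_square_multiple J_inv_square_multiple power_mult_distrib)

lemma cusp_param_if_Disc_eq_0:
  assumes two: "(2::'a::field) \<noteq> 0" and three: "(3::'a) \<noteq> 0" and D: "Disc (f :: 'a poly poly) = 0"
  obtains r where "I_inv f = r^2" "J_inv f = 2 * r^3"
proof (cases "I_inv f = 0")
  case True
  then have "J_inv f = 0" using D by (simp add: Disc_eq_0_iff[OF three])
  then show ?thesis using True by (intro that[of 0]) simp_all
next
  case False
  have D': "J_inv f * J_inv f = 4 * (I_inv f * I_inv f * I_inv f)"
    using D by (simp add: Disc_eq_0_iff[OF three] power2_eq_square power3_eq_cube)
  have four: "(4::'a) \<noteq> 0" by (rule numerals_neq_zero[OF two three])
  define r where "r = J_inv f / (2 * I_inv f)"
  have I: "I_inv f = r^2"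
    using False two four by (simp add: r_def power2_eq_square D')
  have "J_inv f = 2 * I_inv f * r" using False two by (simp add: r_def)
  also have "\<dots> = 2 * r^3" unfolding I by (simp add: power2_eq_square power3_eq_cube)
  finally show ?thesis using I that by blast
qed

text \<open>
  Over a field that need not be closed, the double root is exhibited by a rational formula. After
  removing the second coefficient, a quartic is
  \<open>Z\<^sup>4 + P Z\<^sup>2 + R Z + S\<close> up to scaling, and
  \<open>I = r\<^sup>2\<close>, \<open>J = 2 r\<^sup>3\<close> turns into
  \<open>12 S = r\<^sup>2 - P\<^sup>2\<close> and
  \<open>27 R\<^sup>2 = - 2 (2 P - r)\<^sup>2 (r + P)\<close>. For
  \<open>R \<noteq> 0\<close> this makes \<open>- 3 R / (2 (2 P - r))\<close> a double root,
  and for \<open>R = 0\<close> the quartic is either divisible by \<open>Z\<^sup>2\<close> or a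
  square. A form with \<open>a\<^sub>0 = 0\<close> is \<open>y\<close> times a cubic, which is
  treated in the same way.
\<close>
lemma singular_quartic_cases:
  fixes f :: "'a::field poly poly"
  assumes two: "(2::'a) \<noteq> 0" and three: "(3::'a) \<noteq> 0" and D: "Disc f = 0"
  obtains x where "double_root f x" | "double_root_at_infinity f"
    | c \<alpha> \<beta> \<gamma> where "square_multiple f c \<alpha> \<beta> \<gamma>"
proof -
  obtain r where I: "I_inv f = r^2" and J: "J_inv f = 2 * r^3"
    using cusp_param_if_Disc_eq_0[OF two three D] .
  note [simp] = numerals_neq_zero[OF two three] two three
  let ?a = "qcoeff f"
  consider (quartic) "?a 0 \<noteq> 0" | (cubic) "?a 0 = 0" "?a 1 \<noteq> 0" | (inf) "?a 0 = 0" "?a 1 = 0"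
    by blast
  then show thesis
  proof cases
    case inf
    then show ?thesis by (intro that(2)) (simp add: double_root_at_infinity_def)
  next
    case cubic
    \<comment> \<open>Depressing the cubic \<open>f / y\<close>.\<close>
    define k P R where "k = ?a 2 / (3 * ?a 1)" and "P = ?a 3 / ?a 1 - 3 * k^2"
      and "R = ?a 4 / ?a 1 - k^3 - P * k"
    have f: "?a 2 = 3 * ?a 1 * k" "?a 3 = ?a 1 * (3 * k^2 + P)" "?a 4 = ?a 1 * (k^3 + P * k + R)"
      using cubic by (simp_all add: k_def P_def R_def)
    have I': "I_inv f = ?a 1^2 * (- 3 * P)"
      by (simp only: I_inv_def f cubic) (simp add: algebra_simps power2_eq_square)
    have J': "J_inv f = ?a 1^3 * (- 27 * R)"
      by (simp only: J_inv_def f cubic) (simp add: algebra_simps power2_eq_square power3_eq_cube)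
    have "27 * ?a 1^6 * (4 * P^3 + 27 * R^2) = J_inv f^2 - 4 * I_inv f^3"
      unfolding I' J' by (simp add: algebra_simps power2_eq_square power3_eq_cube eval_nat_numeral)
    then have "27 * ?a 1^6 * (4 * P^3 + 27 * R^2) = 0"
      using D by (simp add: Disc_eq_0_iff[OF three])
    moreover have "(27::'a) = 3 * 3 * 3" by simp
    then have "(27::'a) \<noteq> 0" using three by (metis mult_eq_0_iff)
    ultimately have PR: "4 * P^3 + 27 * R^2 = 0" using cubic by simp
    show ?thesis
    proof (cases "P = 0")
      case True
      then have "R = 0" using PR \<open>(27::'a) \<noteq> 0\<close> by simp
      with True have "double_root f (- k)"
        by (simp only: double_root_def f cubic) (simp add: algebra_simps power2_eq_square power3_eq_cube)
      then show ?thesis by (rule that(1))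
    next
      case False
      \<comment> \<open>The double root of \<open>Z\<^sup>3 + P Z + R\<close> when
        \<open>4 P\<^sup>3 + 27 R\<^sup>2 = 0\<close>.\<close>
      define z where "z = - 3 * R / (2 * P)"
      have z1: "2 * P * z + 3 * R = 0" using False by (simp add: z_def)
      have "3 * (4 * P^2) * (3 * z^2 + P) = 9 * (2 * P * z)^2 + 12 * P^3"
        by (simp add: algebra_simps power2_eq_square power3_eq_cube)
      also have "2 * P * z = - 3 * R" using z1 by (simp add: add_eq_0_iff)
      also have "9 * (- 3 * R)^2 + 12 * P^3 = 3 * (4 * P^3 + 27 * R^2)"
        by (simp add: algebra_simps power2_eq_square)
      finally have z2: "3 * z^2 + P = 0" using PR False by simp
      have z3: "z^3 + P * z + R = 0"
      proof -
        have "3 * (z^3 + P * z + R) = z * (3 * z^2 + P) + (2 * P * z + 3 * R)"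
          by (simp add: algebra_simps power2_eq_square power3_eq_cube)
        then have "3 * (z^3 + P * z + R) = 0" by (simp only: z1 z2) simp
        then show ?thesis by (simp only: mult_eq_0_iff three simp_thms)
      qed
      have "double_root f (z - k)"
      proof -
        have "?a 0 * (z - k)^4 + ?a 1 * (z - k)^3 + ?a 2 * (z - k)^2 + ?a 3 * (z - k) + ?a 4
            = ?a 1 * (z^3 + P * z + R)"
          by (simp only: f cubic) (simp add: algebra_simps power2_eq_square power3_eq_cube)
        moreover have "4 * ?a 0 * (z - k)^3 + 3 * ?a 1 * (z - k)^2 + 2 * ?a 2 * (z - k) + ?a 3
            = ?a 1 * (3 * z^2 + P)"
          by (simp only: f cubic) (simp add: algebra_simps power2_eq_square power3_eq_cube)
        ultimately show ?thesis by (simp add: double_root_def z2 z3)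
      qed
      then show ?thesis by (rule that(1))
    qed
  next
    case quartic
    \<comment> \<open>Depressing the quartic.\<close>
    define k P R S where "k = ?a 1 / (4 * ?a 0)" and "P = ?a 2 / ?a 0 - 6 * k^2"
      and "R = ?a 3 / ?a 0 - 4 * k^3 - 2 * P * k" and "S = ?a 4 / ?a 0 - k^4 - P * k^2 - R * k"
    have f: "?a 1 = 4 * ?a 0 * k" "?a 2 = ?a 0 * (6 * k^2 + P)" "?a 3 = ?a 0 * (4 * k^3 + 2 * P * k + R)"
      "?a 4 = ?a 0 * (k^4 + P * k^2 + R * k + S)"
      using quartic by (simp_all add: k_def P_def R_def S_def)
    define s where "s = r / ?a 0"
    have r: "r = ?a 0 * s" using quartic by (simp add: s_def)
    have "I_inv f = ?a 0^2 * (12 * S + P^2)"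
      by (simp only: I_inv_def f) (simp add: algebra_simps power2_eq_square power3_eq_cube power4_eq_xxxx)
    then have I': "12 * S + P^2 = s^2"
      using quartic by (simp add: I r power_mult_distrib)
    have "J_inv f = ?a 0^3 * (72 * P * S - 27 * R^2 - 2 * P^3)"
      by (simp only: J_inv_def f) (simp add: algebra_simps power2_eq_square power3_eq_cube power4_eq_xxxx)
    then have J': "72 * P * S - 27 * R^2 - 2 * P^3 = 2 * s^3"
      using quartic by (simp add: J r power_mult_distrib)
    have R: "27 * R^2 + 2 * (2 * P - s)^2 * (s + P) = 0"
    proof -
      have "27 * R^2 + 2 * (2 * P - s)^2 * (s + P) = 6 * P * (12 * S + P^2 - s^2) - (72 * P * S - 27 * R^2 - 2 * P^3 - 2 * s^3)"
        by (simp add: algebra_simps power2_eq_square power3_eq_cube)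
      then show ?thesis by (simp add: I' J')
    qed
    show ?thesis
    proof (cases "R = 0")
      case True
      then have "(2 * P - s)^2 * (s + P) = 0" using R by simp
      then consider "s = 2 * P" | "s + P = 0" by auto
      then show ?thesis
      proof cases
        case 1
        have "12 * (4 * S - P^2) = 4 * (12 * S + P^2 - s^2)"
          by (simp add: 1 algebra_simps power2_eq_square)
        then have "12 * (4 * S - P^2) = 0" by (simp only: I') simp
        then have S: "4 * S = P^2"
          by (simp only: mult_eq_0_iff numerals_neq_zero[OF two three] simp_thms eq_iff_diff_eq_0[symmetric])
        have "square_multiple f (?a 0) 1 (2 * k) (k^2 + P / 2)"
        proof -
          have "?a 0 * (k^2 + P / 2)^2 = ?a 0 * (k^4 + P * k^2 + P^2 / 4)"
            by (simp add: algebra_simps power2_eq_square power4_eq_xxxx)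
          also have "P^2 / 4 = S" by (simp add: S[symmetric])
          finally show ?thesis unfolding square_multiple_def using f True
            by (simp add: algebra_simps power2_eq_square power3_eq_cube)
        qed
        then show ?thesis by (rule that(3))
      next
        case 2
        have "12 * S = s^2 - P^2" using I' by (simp add: algebra_simps)
        also have "\<dots> = (s + P) * (s - P)" by (simp add: algebra_simps power2_eq_square)
        finally have "S = 0" using 2 by simp
        then have "double_root f (- k)" using True
          by (simp only: double_root_def f)
            (simp add: algebra_simps power2_eq_square power3_eq_cube power4_eq_xxxx)
        then show ?thesis by (rule that(1))
      qed
    next
      case False
      define u where "u = 2 * P - s"
      have R': "27 * R^2 + 2 * u^2 * (s + P) = 0" using R by (simp add: u_def)
      have u: "u \<noteq> 0"
      proof
        assume "u = 0"
        then have "27 * R^2 = 0" using R' by simp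
        moreover have "(27::'a) = 3 * 3 * 3" by simp
        ultimately show False using False three by (metis mult_eq_0_iff power_not_zero)
      qed
      define z where "z = - 3 * R / (2 * u)"
      have z1: "2 * u * z = - 3 * R" using u by (simp add: z_def)
      have "2 * u^2 * (6 * z^2 + (s + P)) = 3 * (2 * u * z)^2 + 2 * u^2 * (s + P)"
        by (simp add: algebra_simps power2_eq_square)
      also have "\<dots> = 27 * R^2 + 2 * u^2 * (s + P)" by (simp only: z1) (simp add: power2_eq_square)
      finally have z2: "6 * z^2 + (s + P) = 0" using R' u by simp
      have z3: "4 * z^3 + 2 * P * z + R = 0"
      proof -
        have "3 * (4 * z^3 + 2 * P * z + R) = 2 * z * (6 * z^2 + (s + P)) + (2 * u * z - - 3 * R)"
          by (simp add: u_def algebra_simps power2_eq_square power3_eq_cube)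
        then have "3 * (4 * z^3 + 2 * P * z + R) = 0" by (simp only: z1 z2) simp
        then show ?thesis by (simp only: mult_eq_0_iff three simp_thms)
      qed
      have z4: "z^4 + P * z^2 + R * z + S = 0"
      proof -
        have "12 * (z^4 + P * z^2 + R * z + S) = (12 * S + P^2 - s^2) + 4 * z * (2 * u * z - - 3 * R)
            + (2 * z^2 + s - P) * (6 * z^2 + (s + P))"
          by (simp add: u_def algebra_simps power2_eq_square power4_eq_xxxx)
        then have "12 * (z^4 + P * z^2 + R * z + S) = 0" by (simp only: z1 z2 I') simp
        then show ?thesis by (simp only: mult_eq_0_iff numerals_neq_zero[OF two three] simp_thms)
      qed
      have "double_root f (z - k)"
      proof -
        have "?a 0 * (z - k)^4 + ?a 1 * (z - k)^3 + ?a 2 * (z - k)^2 + ?a 3 * (z - k) + ?a 4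
            = ?a 0 * (z^4 + P * z^2 + R * z + S)"
          by (simp only: f) (simp add: algebra_simps power2_eq_square power3_eq_cube power4_eq_xxxx)
        moreover have "4 * ?a 0 * (z - k)^3 + 3 * ?a 1 * (z - k)^2 + 2 * ?a 2 * (z - k) + ?a 3
            = ?a 0 * (4 * z^3 + 2 * P * z + R)"
          by (simp only: f) (simp add: algebra_simps power2_eq_square power3_eq_cube)
        ultimately show ?thesis by (simp add: double_root_def z3 z4)
      qed
      then show ?thesis by (rule that(1))
    qed
  qed
qed

section \<open>The indicator function of the singular forms\<close>

definition double_root_count :: "'a::{field,finite} poly poly \<Rightarrow> int" where
  "double_root_count f = (\<Sum>x\<in>UNIV. if double_root f x then 1 else 0) + (if double_root_at_infinity f then 1 else 0)"

definition square_multiple_sum :: "'a::{field,finite} poly poly \<Rightarrow> int" where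
  "square_multiple_sum f = (\<Sum>(c, \<alpha>, \<beta>, \<gamma>)\<in>{(c, \<alpha>, \<beta>, \<gamma>). c \<noteq> 0 \<and> square_multiple f c \<alpha> \<beta> \<gamma>}.
     qchar (\<beta>^2 - 4 * \<alpha> * \<gamma>))"

text \<open>
  The quartic is determined by its leading coefficient and four Hermite interpolation conditions. Its
  divided differences at \<open>x, x, y, y\<close> and at \<open>x, x, y\<close> vanish, which
  gives \<open>a\<^sub>1\<close> and \<open>a\<^sub>2\<close>.
\<close>
lemma square_multiple_if_two_double_roots:
  fixes f :: "'a::field poly poly"
  assumes "double_root f x" "double_root f y" "x \<noteq> y"
  shows "square_multiple f (qcoeff f 0) 1 (- (x + y)) (x * y)"
proof -
  let ?a = "qcoeff f"
  have nz: "x - y \<noteq> 0" using assms(3) by simp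
  note x = assms(1)[unfolded double_root_def] and y = assms(2)[unfolded double_root_def]
  note xc = x[THEN conjunct1] and xd = x[THEN conjunct2] and yc = y[THEN conjunct1] and yd = y[THEN conjunct2]
  \<comment> \<open>Divided difference at \<open>x, x, y, y\<close>, with the denominator cleared.\<close>
  have "(x - y)^3 * (?a 1 + 2 * ?a 0 * (x + y)) =
      (x - y) * ((4 * ?a 0 * x^3 + 3 * ?a 1 * x^2 + 2 * ?a 2 * x + ?a 3)
        + (4 * ?a 0 * y^3 + 3 * ?a 1 * y^2 + 2 * ?a 2 * y + ?a 3))
      - 2 * ((?a 0 * x^4 + ?a 1 * x^3 + ?a 2 * x^2 + ?a 3 * x + ?a 4)
        - (?a 0 * y^4 + ?a 1 * y^3 + ?a 2 * y^2 + ?a 3 * y + ?a 4))"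
    by (simp add: algebra_simps power2_eq_square power3_eq_cube power4_eq_xxxx)
  then have "(x - y)^3 * (?a 1 + 2 * ?a 0 * (x + y)) = 0" by (simp only: xc xd yc yd) simp
  then have a1: "?a 1 = - 2 * ?a 0 * (x + y)" using nz by (simp add: eq_neg_iff_add_eq_0)
  \<comment> \<open>Divided difference at \<open>x, x, y\<close>, with the denominator cleared.\<close>
  have "(x - y)^2 * (?a 2 + ?a 1 * (2 * x + y) + ?a 0 * (3 * x^2 + 2 * x * y + y^2)) =
      (x - y) * (4 * ?a 0 * x^3 + 3 * ?a 1 * x^2 + 2 * ?a 2 * x + ?a 3)
      - ((?a 0 * x^4 + ?a 1 * x^3 + ?a 2 * x^2 + ?a 3 * x + ?a 4)
        - (?a 0 * y^4 + ?a 1 * y^3 + ?a 2 * y^2 + ?a 3 * y + ?a 4))"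
    by (simp add: algebra_simps power2_eq_square power3_eq_cube power4_eq_xxxx)
  then have "(x - y)^2 * (?a 2 + ?a 1 * (2 * x + y) + ?a 0 * (3 * x^2 + 2 * x * y + y^2)) = 0"
    by (simp only: xc xd yc yd) simp
  then have "?a 2 + ?a 1 * (2 * x + y) + ?a 0 * (3 * x^2 + 2 * x * y + y^2) = 0" using nz by simp
  then have "?a 2 = - (?a 1 * (2 * x + y) + ?a 0 * (3 * x^2 + 2 * x * y + y^2))"
    by (simp only: eq_neg_iff_add_eq_0 ac_simps)
  also have "\<dots> = ?a 0 * ((x + y)^2 + 2 * x * y)"
    by (simp only: a1) (simp add: algebra_simps power2_eq_square)
  finally have a2: "?a 2 = ?a 0 * ((x + y)^2 + 2 * x * y)" .
  show ?thesis
    using assms(1)[unfolded double_root_iff a1 a2] a1 a2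
    by (simp add: square_multiple_def algebra_simps power2_eq_square power3_eq_cube power4_eq_xxxx)
qed

lemma square_multiple_if_double_root_and_infinity:
  assumes "double_root f x" "double_root_at_infinity f"
  shows "square_multiple f (qcoeff f 2) 0 1 (- x)"
  using assms
  by (simp add: square_multiple_def double_root_iff double_root_at_infinity_def)

lemma double_root_square_multiple:
  fixes f :: "'a::field poly poly"
  assumes f: "square_multiple f c \<alpha> \<beta> \<gamma>" and c: "c \<noteq> 0"
  shows "double_root f x \<longleftrightarrow> \<alpha> * x^2 + \<beta> * x + \<gamma> = 0"
proof -
  let ?Q = "\<alpha> * x^2 + \<beta> * x + \<gamma>"
  have "qcoeff f 0 * x^4 + qcoeff f 1 * x^3 + qcoeff f 2 * x^2 + qcoeff f 3 * x + qcoeff f 4 = c * ?Q^2"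
    using f by (simp add: square_multiple_def algebra_simps power2_eq_square power3_eq_cube power4_eq_xxxx)
  moreover have "4 * qcoeff f 0 * x^3 + 3 * qcoeff f 1 * x^2 + 2 * qcoeff f 2 * x + qcoeff f 3
      = c * (2 * (2 * \<alpha> * x + \<beta>)) * ?Q"
    using f by (simp add: square_multiple_def algebra_simps power2_eq_square power3_eq_cube)
  ultimately show ?thesis using c by (auto simp: double_root_def)
qed

lemma double_root_count_square_multiple:
  fixes f :: "'a::{field,finite} poly poly"
  assumes two: "(2::'a) \<noteq> 0" and f: "square_multiple f c \<alpha> \<beta> \<gamma>" and nz: "c * (\<beta>^2 - 4 * \<alpha> * \<gamma>) \<noteq> 0"
  shows "double_root_count f = 1 + qchar (\<beta>^2 - 4 * \<alpha> * \<gamma>)"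
proof -
  have c: "c \<noteq> 0" using nz by auto
  have inf: "double_root_at_infinity f \<longleftrightarrow> \<alpha> = 0"
    using f c by (auto simp: double_root_at_infinity_def square_multiple_def)
  have four: "(4::'a) \<noteq> 0" using two by (metis mult_2 mult_eq_0_iff numeral_Bit0)
  show ?thesis
  proof (cases "\<alpha> = 0")
    case True
    then have \<beta>: "\<beta> \<noteq> 0" using nz by auto
    have "\<beta> * x + \<gamma> = 0 \<longleftrightarrow> x = - \<gamma> / \<beta>" for x
      using \<beta> by (simp only: nonzero_eq_divide_eq[OF \<beta>] eq_neg_iff_add_eq_0 mult.commute)
    then show ?thesis using True \<beta>
      by (simp add: double_root_count_def double_root_square_multiple[OF f c] inf qchar_square)
  next
    case False
    have "\<alpha> * x^2 + \<beta> * x + \<gamma> = 0 \<longleftrightarrow> (2 * \<alpha> * x + \<beta>)^2 = \<beta>^2 - 4 * \<alpha> * \<gamma>" for x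
    proof -
      have "(2 * \<alpha> * x + \<beta>)^2 - (\<beta>^2 - 4 * \<alpha> * \<gamma>) = 4 * \<alpha> * (\<alpha> * x^2 + \<beta> * x + \<gamma>)"
        by (simp add: algebra_simps power2_eq_square)
      then show ?thesis using False four by (metis eq_iff_diff_eq_0 mult_eq_0_iff)
    qed
    then have "(\<Sum>x\<in>UNIV. if \<alpha> * x^2 + \<beta> * x + \<gamma> = 0 then 1 else 0 :: int) =
        (\<Sum>x\<in>UNIV. if (2 * \<alpha> * x + \<beta>)^2 = \<beta>^2 - 4 * \<alpha> * \<gamma> then 1 else 0)" by simp
    also have "\<dots> = (\<Sum>u\<in>UNIV. if u^2 = \<beta>^2 - 4 * \<alpha> * \<gamma> then 1 else 0)"
      using False two by (intro sum_affine) simp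
    also have "\<dots> = 1 + qchar (\<beta>^2 - 4 * \<alpha> * \<gamma>)"
      by (simp only: sum_indicator card_square_roots[OF two])
    finally show ?thesis using False
      by (simp add: double_root_count_def double_root_square_multiple[OF f c] inf)
  qed
qed

lemma square_multiple_scale:
  assumes "square_multiple f c \<alpha> \<beta> \<gamma>" "(u::'a::field) \<noteq> 0"
  shows "square_multiple f (c / u^2) (u * \<alpha>) (u * \<beta>) (u * \<gamma>)"
proof -
  define c' where "c' = c / u^2"
  have c: "c = c' * u^2" using assms(2) by (simp add: c'_def)
  show ?thesis using assms(1) unfolding c'_def[symmetric]
    by (simp add: c square_multiple_def power2_eq_square algebra_simps)
qed

text \<open>
  The quotient of the scalars is a square, because some coefficient of \<open>Q\<close> appears
  squared in \<open>c Q\<^sup>2\<close>. After absorbing its root, two polynomials have the same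
  square, hence agree up to sign.
\<close>
lemma square_multiple_unique:
  fixes f :: "'a::field poly poly"
  assumes f: "square_multiple f c \<alpha> \<beta> \<gamma>" and f': "square_multiple f c' \<alpha>' \<beta>' \<gamma>'"
    and c: "c \<noteq> 0" and c': "c' \<noteq> 0" and nz: "\<beta>^2 - 4 * \<alpha> * \<gamma> \<noteq> 0"
  obtains u where "u \<noteq> 0" "c' = c / u^2" "\<alpha>' = u * \<alpha>" "\<beta>' = u * \<beta>" "\<gamma>' = u * \<gamma>"
proof -
  have eqs: "c * \<alpha>^2 = c' * \<alpha>'^2" "c * (2 * \<alpha> * \<beta>) = c' * (2 * \<alpha>' * \<beta>')"
    "c * (\<beta>^2 + 2 * \<alpha> * \<gamma>) = c' * (\<beta>'^2 + 2 * \<alpha>' * \<gamma>')" "c * (2 * \<beta> * \<gamma>) = c' * (2 * \<beta>' * \<gamma>')"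
    "c * \<gamma>^2 = c' * \<gamma>'^2"
    using f f' by (auto simp: square_multiple_def)
  have "\<exists>k. c = c' * k^2"
  proof -
    have "\<alpha> \<noteq> 0 \<or> \<gamma> \<noteq> 0 \<or> \<beta> \<noteq> 0" using nz by auto
    then consider "\<alpha> \<noteq> 0" | "\<gamma> \<noteq> 0" | "\<alpha> = 0" "\<gamma> = 0" "\<beta> \<noteq> 0"
      by blast
    then show ?thesis
    proof cases
      case 1
      then show ?thesis using eqs(1) by (intro exI[of _ "\<alpha>' / \<alpha>"]) (simp add: field_simps)
    next
      case 2
      then show ?thesis using eqs(5) by (intro exI[of _ "\<gamma>' / \<gamma>"]) (simp add: field_simps)
    next
      case 3
      then have "\<alpha>' = 0" using eqs(1) c' by simp
      then show ?thesis using eqs(3) 3 by (intro exI[of _ "\<beta>' / \<beta>"]) (simp add: field_simps)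
    qed
  qed
  then obtain k where k: "c = c' * k^2" ..
  have sq: "[:z, y, x:]^2 = [:z^2, 2 * y * z, y^2 + 2 * x * z, 2 * x * y, x^2:]" for x y z :: 'a
    by (simp add: power2_eq_square algebra_simps)
  have "[:\<gamma>', \<beta>', \<alpha>':]^2 = [:k * \<gamma>, k * \<beta>, k * \<alpha>:]^2"
  proof -
    have "c' * (k^2 * t) = c' * t' \<Longrightarrow> t' = k^2 * t" for t t' using c' by simp
    note * = this[of "\<alpha>^2" "\<alpha>'^2"] this[of "2 * \<alpha> * \<beta>" "2 * \<alpha>' * \<beta>'"]
      this[of "\<beta>^2 + 2 * \<alpha> * \<gamma>" "\<beta>'^2 + 2 * \<alpha>' * \<gamma>'"] this[of "2 * \<beta> * \<gamma>" "2 * \<beta>' * \<gamma>'"]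
      this[of "\<gamma>^2" "\<gamma>'^2"]
    show ?thesis
      using *(1)[OF eqs(1)[unfolded k mult.assoc[of c']]] *(2)[OF eqs(2)[unfolded k mult.assoc[of c']]]
        *(3)[OF eqs(3)[unfolded k mult.assoc[of c']]] *(4)[OF eqs(4)[unfolded k mult.assoc[of c']]]
        *(5)[OF eqs(5)[unfolded k mult.assoc[of c']]]
      unfolding sq by (simp add: power2_eq_square algebra_simps)
  qed
  then have "[:\<gamma>', \<beta>', \<alpha>':] = [:k * \<gamma>, k * \<beta>, k * \<alpha>:] \<or> [:\<gamma>', \<beta>', \<alpha>':] = - [:k * \<gamma>, k * \<beta>, k * \<alpha>:]"
    by (simp only: power2_eq_iff)
  then have "\<exists>u. u^2 = k^2 \<and> \<alpha>' = u * \<alpha> \<and> \<beta>' = u * \<beta> \<and> \<gamma>' = u * \<gamma>"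
    by (elim disjE) (intro exI[of _ k], simp, intro exI[of _ "- k"], simp)
  then obtain u where u: "u^2 = k^2" "\<alpha>' = u * \<alpha>" "\<beta>' = u * \<beta>" "\<gamma>' = u * \<gamma>"
    by blast
  have "k \<noteq> 0" using k c by auto
  then have "u \<noteq> 0" "c' = c / u^2" using u(1) k by auto
  then show thesis using u that by blast
qed

lemma square_multiple_sum_square:
  fixes f :: "'a::{field,finite} poly poly"
  assumes f: "square_multiple f c \<alpha> \<beta> \<gamma>" and nz: "c * (\<beta>^2 - 4 * \<alpha> * \<gamma>) \<noteq> 0"
  shows "square_multiple_sum f = (int CARD('a) - 1) * qchar (\<beta>^2 - 4 * \<alpha> * \<gamma>)"
proof -
  have c: "c \<noteq> 0" and D: "\<beta>^2 - 4 * \<alpha> * \<gamma> \<noteq> 0" using nz by auto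
  let ?g = "\<lambda>u. (c / u^2, u * \<alpha>, u * \<beta>, u * \<gamma>)"
  have "\<alpha> \<noteq> 0 \<or> \<beta> \<noteq> 0 \<or> \<gamma> \<noteq> 0" using D by auto
  then have inj: "inj_on ?g (UNIV - {0})" by (auto intro!: inj_onI)
  have "{(c', \<alpha>', \<beta>', \<gamma>'). c' \<noteq> 0 \<and> square_multiple f c' \<alpha>' \<beta>' \<gamma>'} = ?g ` (UNIV - {0})"
  proof (intro equalityI subsetI)
    fix v assume "v \<in> {(c', \<alpha>', \<beta>', \<gamma>'). c' \<noteq> 0 \<and> square_multiple f c' \<alpha>' \<beta>' \<gamma>'}"
    then obtain c' \<alpha>' \<beta>' \<gamma>' where v: "v = (c', \<alpha>', \<beta>', \<gamma>')" "c' \<noteq> 0" "square_multiple f c' \<alpha>' \<beta>' \<gamma>'" by blast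
    from square_multiple_unique[OF f v(3) c v(2) D] obtain u where "u \<noteq> 0" "v = ?g u" using v(1)
      by metis
    then show "v \<in> ?g ` (UNIV - {0})" by blast
  qed (use c square_multiple_scale[OF f] in auto)
  then have "square_multiple_sum f = (\<Sum>u\<in>UNIV - {0}. qchar ((u * \<beta>)^2 - 4 * (u * \<alpha>) * (u * \<gamma>)))"
    by (simp add: square_multiple_sum_def sum.reindex[OF inj])
  also have "\<dots> = (\<Sum>u\<in>UNIV - {0::'a}. qchar (\<beta>^2 - 4 * \<alpha> * \<gamma>))"
  proof (rule sum.cong[OF refl])
    fix u :: 'a assume "u \<in> UNIV - {0}"
    moreover have "(u * \<beta>)^2 - 4 * (u * \<alpha>) * (u * \<gamma>) = u^2 * (\<beta>^2 - 4 * \<alpha> * \<gamma>)"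
      by (simp add: power2_eq_square algebra_simps)
    ultimately show "qchar ((u * \<beta>)^2 - 4 * (u * \<alpha>) * (u * \<gamma>)) = qchar (\<beta>^2 - 4 * \<alpha> * \<gamma>)"
      by (simp add: qchar_mult_square)
  qed
  finally show ?thesis by (simp add: card_Diff_singleton of_nat_diff)
qed

text \<open>
  For \<open>f = c Q\<^sup>2\<close> with \<open>disc Q \<noteq> 0\<close> the double roots
  number \<open>1 + \<chi>(disc Q)\<close> and the representations contribute
  \<open>(p - 1) \<chi>(disc Q)\<close>. For \<open>f = 0\<close> all \<open>p + 1\<close>
  points are double roots, of which one is to be kept. In all other cases a double root exists
  precisely when the discriminant vanishes, and two of them would make \<open>f\<close> such a square.
\<close>
lemma singular_indicator:
  fixes f :: "'a::{field,finite} poly poly"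
  assumes two: "(2::'a) \<noteq> 0" and three: "(3::'a) \<noteq> 0"
  shows "(int CARD('a) - 1) * (if Disc f = 0 then 1 else 0) =
    (int CARD('a) - 1) * double_root_count f - square_multiple_sum f
      - (if \<forall>i\<le>4. qcoeff f i = 0 then int CARD('a) * (int CARD('a) - 1) else 0)"
proof -
  have all: "(\<forall>i\<le>4. qcoeff f i = 0) \<longleftrightarrow> qcoeff f 0 = 0 \<and> qcoeff f 1 = 0 \<and> qcoeff f 2 = 0 \<and> qcoeff f 3 = 0 \<and> qcoeff f 4 = 0"
    by (auto simp: le_Suc_eq numeral_eq_Suc)
  consider (zero) "\<forall>i\<le>4. qcoeff f i = 0"
    | (square) c \<alpha> \<beta> \<gamma> where "square_multiple f c \<alpha> \<beta> \<gamma>" "c * (\<beta>^2 - 4 * \<alpha> * \<gamma>) \<noteq> 0"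
    | (other) "\<not> (\<forall>i\<le>4. qcoeff f i = 0)" "\<And>c \<alpha> \<beta> \<gamma>. square_multiple f c \<alpha> \<beta> \<gamma> \<Longrightarrow> c * (\<beta>^2 - 4 * \<alpha> * \<gamma>) = 0"
    by blast
  then show ?thesis
  proof cases
    case zero
    have "square_multiple_sum f = 0"
      unfolding square_multiple_sum_def
      by (rule sum.neutral) (use zero[unfolded all] in \<open>auto simp: square_multiple_def\<close>)
    then show ?thesis using zero unfolding all
      by (simp add: double_root_count_def double_root_def double_root_at_infinity_def Disc_def
          I_inv_def J_inv_def algebra_simps)
  next
    case square
    from square have "\<not> (\<forall>i\<le>4. qcoeff f i = 0)"
      by (auto simp: all square_multiple_def)
    then show ?thesis
      unfolding if_not_P[OF \<open>\<not> (\<forall>i\<le>4. qcoeff f i = 0)\<close>]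
      by (simp add: double_root_count_square_multiple[OF two square] square_multiple_sum_square[OF square]
        Disc_square_multiple[OF square(1)] algebra_simps)
  next
    case other
    have "square_multiple_sum f = 0"
      unfolding square_multiple_sum_def
      by (rule sum.neutral) (use other(2) in fastforce)
    moreover have "double_root_count f = (if Disc f = 0 then 1 else 0)"
    proof (cases "Disc f = 0")
      case False
      then have "\<not> double_root f x" "\<not> double_root_at_infinity f" for x
        using Disc_double_root Disc_double_root_at_infinity by blast+
      then show ?thesis using False by (simp add: double_root_count_def)
    next
      case True
      have unique: "x = y" if "double_root f x" "double_root f y" for x y
      proof (rule ccontr)
        assume "x \<noteq> y"
        note sq = square_multiple_if_two_double_roots[OF that this]
        have "(- (x + y))^2 - 4 * 1 * (x * y) = (x - y)^2"
          by (simp add: power2_eq_square algebra_simps)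
        then have "qcoeff f 0 * (x - y)^2 = 0" using other(2)[OF sq] by simp
        then have "qcoeff f 0 = 0" using \<open>x \<noteq> y\<close> by simp
        then show False using sq other(1) by (simp add: square_multiple_def all)
      qed
      have not_inf: "\<not> double_root_at_infinity f" if "double_root f x" for x
      proof
        assume inf: "double_root_at_infinity f"
        note sq = square_multiple_if_double_root_and_infinity[OF that inf]
        then have "qcoeff f 2 = 0" using other(2)[OF sq] by simp
        then show False using sq other(1) by (simp add: square_multiple_def all)
      qed
      have "(\<exists>x. double_root f x) \<or> double_root_at_infinity f"
      proof (cases rule: singular_quartic_cases[OF two three True])
        case (3 c \<alpha> \<beta> \<gamma>)
        have c: "c \<noteq> 0" using 3 other(1) by (auto simp: square_multiple_def all)
        then have D: "\<beta>^2 = 4 * \<alpha> * \<gamma>" using other(2)[OF 3] by simp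
        show ?thesis
        proof (cases "\<alpha> = 0")
          case True
          then show ?thesis using 3 by (simp add: double_root_at_infinity_def square_multiple_def)
        next
          case False
          have four: "(4::'a) \<noteq> 0" by (rule numerals_neq_zero[OF two three])
          define x where "x = - \<beta> / (2 * \<alpha>)"
          have x: "2 * \<alpha> * x = - \<beta>" using False two by (simp add: x_def)
          have "4 * \<alpha> * (\<alpha> * x^2 + \<beta> * x + \<gamma>) = (2 * \<alpha> * x)^2 + 2 * \<beta> * (2 * \<alpha> * x) + 4 * \<alpha> * \<gamma>"
            by (simp add: power2_eq_square algebra_simps)
          also have "\<dots> = 4 * \<alpha> * \<gamma> - \<beta>^2"
            by (simp only: x) (simp add: power2_eq_square)
          finally have "double_root f x"
            using False four by (simp add: double_root_square_multiple[OF 3 c] D)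
          then show ?thesis by blast
        qed
      qed auto
      then consider x where "double_root f x" | "double_root_at_infinity f" by blast
      then show ?thesis
      proof cases
        case 1
        then have "double_root f y \<longleftrightarrow> y = x" for y using unique by blast
        then show ?thesis using True not_inf[OF 1] by (simp add: double_root_count_def)
      next
        case 2
        then have "\<not> double_root f x" for x using not_inf by blast
        then show ?thesis using True 2 by (simp add: double_root_count_def)
      qed
    qed
    ultimately show ?thesis unfolding if_not_P[OF other(1)] by simp
  qed
qed

section \<open>The Fourier transform of the singular forms\<close>

definition quartic :: "'a::comm_ring_1 \<Rightarrow> 'a \<Rightarrow> 'a \<Rightarrow> 'a \<Rightarrow> 'a \<Rightarrow> 'a poly poly" where
  "quartic a0 a1 a2 a3 a4 = [:[:0, 0, 0, 0, a0:], [:0, 0, 0, a1:], [:0, 0, a2:], [:0, a3:], [:a4:]:]"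

lemma qcoeff_quartic [simp]:
  "qcoeff (quartic a0 a1 a2 a3 a4) 0 = a0" "qcoeff (quartic a0 a1 a2 a3 a4) 1 = a1"
  "qcoeff (quartic a0 a1 a2 a3 a4) (Suc 0) = a1"
  "qcoeff (quartic a0 a1 a2 a3 a4) 2 = a2" "qcoeff (quartic a0 a1 a2 a3 a4) 3 = a3"
  "qcoeff (quartic a0 a1 a2 a3 a4) 4 = a4"
  by (simp_all add: qcoeff_def quartic_def numeral_eq_Suc)

lemma quartic_in_V: "quartic a0 a1 a2 a3 a4 \<in> V"
  by (auto simp: V_def binary_form_def quartic_def coeff_pCons split: nat.splits)

lemma V_eq_quartic:
  assumes "f \<in> V"
  shows "f = quartic (qcoeff f 0) (qcoeff f 1) (qcoeff f 2) (qcoeff f 3) (qcoeff f 4)"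
proof (intro poly_eqI)
  fix i j
  let ?g = "quartic (qcoeff f 0) (qcoeff f 1) (qcoeff f 2) (qcoeff f 3) (qcoeff f 4)"
  show "coeff (coeff f i) j = coeff (coeff ?g i) j"
  proof (cases "i + j = 4")
    case True
    then have "i \<in> {0, 1, 2, 3, 4}" "j = 4 - i" by auto
    then have "qcoeff f i = qcoeff ?g i" by auto
    then show ?thesis using \<open>j = 4 - i\<close> by (simp add: qcoeff_def)
  next
    case False
    then show ?thesis using assms quartic_in_V[of "qcoeff f 0" "qcoeff f 1" "qcoeff f 2" "qcoeff f 3" "qcoeff f 4"]
      unfolding V_def binary_form_def mem_Collect_eq by metis
  qed
qed

lemma V_eqI:
  assumes "f \<in> V" "g \<in> V" "qcoeff f 0 = qcoeff g 0" "qcoeff f 1 = qcoeff g 1"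
    "qcoeff f 2 = qcoeff g 2" "qcoeff f 3 = qcoeff g 3" "qcoeff f 4 = qcoeff g 4"
  shows "f = g"
  using V_eq_quartic[OF assms(1)] V_eq_quartic[OF assms(2)] assms(3-7) by simp

lemma zero_in_V: "0 \<in> V"
  by (simp add: V_def binary_form_def)

lemma qcoeff_zero [simp]: "qcoeff 0 i = 0"
  by (simp add: qcoeff_def)

lemma V_eq_0_iff: "f \<in> V \<Longrightarrow> f = 0 \<longleftrightarrow> (\<forall>i\<le>4. qcoeff f i = 0)"
  using V_eqI[OF _ zero_in_V, of f] by auto

lemma finite_V: "finite (V :: 'a::{comm_ring_1,finite} poly poly set)"
proof -
  have "(V :: 'a poly poly set) \<subseteq> (\<lambda>(a0, a1, a2, a3, a4). quartic a0 a1 a2 a3 a4) ` UNIV"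
  proof
    fix f :: "'a poly poly" assume "f \<in> V"
    from V_eq_quartic[OF this] show "f \<in> (\<lambda>(a0, a1, a2, a3, a4). quartic a0 a1 a2 a3 a4) ` UNIV"
      by (intro image_eqI[of _ _ "(qcoeff f 0, qcoeff f 1, qcoeff f 2, qcoeff f 3, qcoeff f 4)"]) simp_all
  qed
  then show ?thesis by (rule finite_subset) simp
qed

lemma add_char_0 [simp]: "add_char 0 = 1"
  by (simp add: add_char_def)

lemma add_char_eq_cis: "add_char (x :: 'p::prime_card mod_ring) = cis (2 * pi * of_int (to_int_mod_ring x) / of_nat CARD('p))"
  by (simp add: add_char_def cis_conv_exp algebra_simps)

lemma add_char_add:
  fixes x y :: "'p::prime_card mod_ring"
  shows "add_char (x + y) = add_char x * add_char y"
proof -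
  let ?p = "int CARD('p)" and ?m = "to_int_mod_ring x + to_int_mod_ring y"
  have p: "CARD('p) \<noteq> 0" by simp
  have "real_of_int ?m = of_int (?m mod ?p) + real CARD('p) * of_int (?m div ?p)"
    by (metis mult_div_mod_eq add.commute of_int_add of_int_mult of_int_of_nat_eq)
  then have "2 * pi * of_int ?m / real CARD('p) = 2 * pi * of_int (?m mod ?p) / real CARD('p) + 2 * pi * of_int (?m div ?p)"
    using p by (simp add: field_simps)
  moreover have "cis (2 * pi * real_of_int n) = 1" for n
    using cis_multiple_2pi[of "real_of_int n"] by simp
  ultimately have "cis (2 * pi * of_int ?m / real CARD('p)) = cis (2 * pi * of_int (?m mod ?p) / real CARD('p))"
    by (simp only: cis_mult[symmetric] mult_1_right)
  moreover have "2 * pi * of_int ?m / real CARD('p) = 2 * pi * of_int (to_int_mod_ring x) / real CARD('p)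
      + 2 * pi * of_int (to_int_mod_ring y) / real CARD('p)"
    by (simp add: distrib_left add_divide_distrib)
  ultimately show ?thesis
    by (simp only: add_char_eq_cis to_int_mod_ring_add cis_mult)
qed

lemma add_char_1_neq_1: "add_char (1 :: 'p::prime_card mod_ring) \<noteq> 1"
proof
  have p: "CARD('p) > 1" using prime_card[where 'a='p] prime_gt_1_nat by blast
  assume "add_char (1 :: 'p mod_ring) = 1"
  then have "cos (2 * pi / of_nat CARD('p)) = 1"
    by (auto simp: add_char_eq_cis complex_eq_iff)
  then obtain n :: int where "2 * pi / of_nat CARD('p) = of_int n * 2 * pi"
    unfolding cos_one_2pi_int by auto
  then have "1 = real_of_int n * real CARD('p)" using p by (simp add: field_simps)
  then have "1 = int CARD('p) * n"
    by (metis mult.commute of_int_1 of_int_eq_iff of_int_mult of_int_of_nat_eq)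
  then have "int CARD('p) dvd 1" by (rule dvdI)
  then show False using p by simp
qed

lemma sum_add_char:
  fixes l :: "'p::prime_card mod_ring"
  shows "(\<Sum>x\<in>UNIV. add_char (x * l)) = (if l = 0 then of_nat CARD('p) else 0)"
proof (cases "l = 0")
  case False
  let ?S = "\<Sum>x\<in>UNIV. add_char (x :: 'p mod_ring)"
  have "?S = (\<Sum>x\<in>UNIV. add_char (x + 1 :: 'p mod_ring))"
    using sum_affine[of "1 :: 'p mod_ring" add_char 1] by simp
  also have "\<dots> = ?S * add_char (1 :: 'p mod_ring)" by (simp add: add_char_add sum_distrib_right)
  finally have "?S = 0" using add_char_1_neq_1[where 'p='p] by simp
  then show ?thesis using False sum_affine[OF False, of add_char 0] by (simp add: mult.commute)
qed simp

lemma sum_nonzero_add_char: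
  fixes l :: "'p::prime_card mod_ring"
  shows "(\<Sum>x\<in>UNIV - {0}. add_char (x * l)) = (if l = 0 then of_nat CARD('p) else 0) - 1"
  by (subst sum_add_char[symmetric], subst sum.remove[of UNIV 0]) auto

lemma twelve_times_div:
  fixes x :: "'a::field"
  assumes two: "(2::'a) \<noteq> 0" and three: "(3::'a) \<noteq> 0"
  shows "12 * (x / 4) = 3 * x" "12 * (x / 6) = 2 * x"
proof -
  note nz = numerals_neq_zero[OF two three]
  have "12 * (x / 4) = 3 * (4 * (x / 4))" by (simp only: mult.assoc[symmetric]) simp
  then show "12 * (x / 4) = 3 * x" using nz by simp
  have "12 * (x / 6) = 2 * (6 * (x / 6))" by (simp only: mult.assoc[symmetric]) simp
  then show "12 * (x / 6) = 2 * x" using nz by simp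
qed

lemma twelve_pairing:
  fixes f h :: "'a::field poly poly"
  assumes two: "(2::'a) \<noteq> 0" and three: "(3::'a) \<noteq> 0"
  shows "12 * pairing h f = 12 * (qcoeff h 0 * qcoeff f 0) + 3 * (qcoeff h 1 * qcoeff f 1)
    + 2 * (qcoeff h 2 * qcoeff f 2) + 3 * (qcoeff h 3 * qcoeff f 3) + 12 * (qcoeff h 4 * qcoeff f 4)"
  by (simp only: pairing_def distrib_left twelve_times_div[OF two three])

text \<open>
  The form \<open>f\<close> is divisible by the cube of \<open>x X + Y\<close>, with the cofactor
  eliminated. At infinity the linear form is \<open>X\<close>.
\<close>
definition cube_root :: "'a::field poly poly \<Rightarrow> 'a \<Rightarrow> bool" where
  "cube_root f x \<longleftrightarrow> qcoeff f 0 = x^3 * qcoeff f 3 - 3 * x^4 * qcoeff f 4 \<and>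
     qcoeff f 1 = 3 * x^2 * qcoeff f 3 - 8 * x^3 * qcoeff f 4 \<and>
     qcoeff f 2 = 3 * x * qcoeff f 3 - 6 * x^2 * qcoeff f 4"

definition cube_root_at_infinity :: "'a::field poly poly \<Rightarrow> bool" where
  "cube_root_at_infinity f \<longleftrightarrow> qcoeff f 2 = 0 \<and> qcoeff f 3 = 0 \<and> qcoeff f 4 = 0"

definition cube_root_count :: "'a::{field,finite} poly poly \<Rightarrow> int" where
  "cube_root_count f = (\<Sum>x\<in>UNIV. if cube_root f x then 1 else 0) + (if cube_root_at_infinity f then 1 else 0)"

lemma sum_linear_add_char:
  fixes k l m :: "'p::prime_card mod_ring"
  shows "(\<Sum>(x, y, z)\<in>UNIV. add_char (x * k + y * l + z * m)) =
    (if k = 0 \<and> l = 0 \<and> m = 0 then of_nat CARD('p)^3 else 0)"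
proof -
  have "(\<Sum>(x, y, z)\<in>UNIV. add_char (x * k + y * l + z * m)) =
      (\<Sum>x\<in>UNIV. \<Sum>y\<in>UNIV. \<Sum>z\<in>UNIV. add_char (x * k) * (add_char (y * l) * add_char (z * m)))"
    by (simp add: add_char_add UNIV_Times_UNIV[symmetric] sum.cartesian_product[symmetric]
        mult.assoc del: UNIV_Times_UNIV)
  also have "\<dots> = (\<Sum>x\<in>UNIV. add_char (x * k)) * ((\<Sum>y\<in>UNIV. add_char (y * l)) * (\<Sum>z\<in>UNIV. add_char (z * m)))"
    by (simp only: sum_distrib_left[symmetric] sum_distrib_right[symmetric])
  finally have "(\<Sum>(x, y, z)\<in>UNIV. add_char (x * k + y * l + z * m)) =
      (\<Sum>x\<in>UNIV. add_char (x * k)) * ((\<Sum>y\<in>UNIV. add_char (y * l)) * (\<Sum>z\<in>UNIV. add_char (z * m)))" .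
  then show ?thesis by (simp add: sum_add_char power3_eq_cube)
qed

text \<open>
  Solving for the last two coefficients parametrises the forms with a double root at \<open>x\<close>
  by the first three. The pairing with \<open>f\<close> becomes a linear form in these, which vanishes
  exactly when \<open>f\<close> lies in the annihilator.
\<close>
lemma fourier_double_root:
  fixes f :: "'p::prime_card mod_ring poly poly"
  assumes two: "(2::'p mod_ring) \<noteq> 0" and three: "(3::'p mod_ring) \<noteq> 0"
  shows "(\<Sum>h\<in>V. (if double_root h x then 1 else 0) * add_char (pairing h f)) =
    (if cube_root f x then of_nat CARD('p)^3 else 0)"
proof -
  note [simp] = numerals_neq_zero[OF two three] two three
  let ?b = "qcoeff f"
  let ?g = "\<lambda>(a0, a1, a2). quartic a0 a1 a2 (- (4 * a0 * x^3 + 3 * a1 * x^2 + 2 * a2 * x))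
    (3 * a0 * x^4 + 2 * a1 * x^3 + a2 * x^2)"
  have set: "{h \<in> V. double_root h x} = ?g ` UNIV"
  proof (intro equalityI subsetI)
    fix h assume h: "h \<in> {h \<in> V. double_root h x}"
    then have "h = ?g (qcoeff h 0, qcoeff h 1, qcoeff h 2)"
      using quartic_in_V by (intro V_eqI) (auto simp: double_root_iff)
    then show "h \<in> ?g ` UNIV" by blast
  qed (auto simp: double_root_iff quartic_in_V)
  have inj: "inj ?g"
  proof (rule injI)
    fix u v assume "?g u = ?g v"
    then have "qcoeff (?g u) i = qcoeff (?g v) i" for i by simp
    from this[of 0] this[of 1] this[of 2] show "u = v" by (cases u, cases v) simp
  qed
  let ?k = "?b 0 - x^3 * ?b 3 + 3 * x^4 * ?b 4" and ?l = "(?b 1 - 3 * x^2 * ?b 3 + 8 * x^3 * ?b 4) / 4"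
    and ?m = "(?b 2 - 3 * x * ?b 3 + 6 * x^2 * ?b 4) / 6"
  have pair: "pairing (?g (a0, a1, a2)) f = a0 * ?k + a1 * ?l + a2 * ?m" for a0 a1 a2
  proof -
    have "12 * (a0 * k + a1 * (l / 4) + a2 * (m / 6)) = a0 * (12 * k) + a1 * (3 * l) + a2 * (2 * m)" for k l m
      by (simp only: distrib_left mult.left_commute[of 12] twelve_times_div[OF two three])
    then have "12 * (a0 * ?k + a1 * ?l + a2 * ?m) = a0 * (12 * ?k) + a1 * (3 * (?b 1 - 3 * x^2 * ?b 3 + 8 * x^3 * ?b 4))
        + a2 * (2 * (?b 2 - 3 * x * ?b 3 + 6 * x^2 * ?b 4))" .
    also have "\<dots> = 12 * pairing (?g (a0, a1, a2)) f"
      by (simp add: twelve_pairing[OF two three] algebra_simps)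
    finally show ?thesis by (simp only: mult_cancel_left numerals_neq_zero[OF two three] simp_thms)
  qed
  have "(\<Sum>h\<in>V. (if double_root h x then 1 else 0) * add_char (pairing h f)) = (\<Sum>h\<in>{h \<in> V. double_root h x}. add_char (pairing h f))"
    by (auto intro!: sum.cong simp: sum.inter_filter[OF finite_V])
  also have "\<dots> = (\<Sum>v\<in>UNIV. add_char (pairing (?g v) f))"
    unfolding set by (subst sum.reindex[OF inj]) simp
  also have "\<dots> = (\<Sum>(a0, a1, a2)\<in>UNIV. add_char (a0 * ?k + a1 * ?l + a2 * ?m))"
    by (rule sum.cong[OF refl]) (simp only: split_paired_all pair[unfolded prod.case] prod.case)
  also have "\<dots> = (if ?k = 0 \<and> ?l = 0 \<and> ?m = 0 then of_nat CARD('p)^3 else 0)"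
    by (rule sum_linear_add_char)
  also have "?k = 0 \<and> ?l = 0 \<and> ?m = 0 \<longleftrightarrow> cube_root f x"
  proof -
    have "?k = ?b 0 - (x^3 * ?b 3 - 3 * x^4 * ?b 4)"
      and "?b 1 - 3 * x^2 * ?b 3 + 8 * x^3 * ?b 4 = ?b 1 - (3 * x^2 * ?b 3 - 8 * x^3 * ?b 4)"
      and "?b 2 - 3 * x * ?b 3 + 6 * x^2 * ?b 4 = ?b 2 - (3 * x * ?b 3 - 6 * x^2 * ?b 4)" by simp_all
    then show ?thesis by (simp only: cube_root_def divide_eq_0_iff numerals_neq_zero[OF two three] simp_thms right_minus_eq)
  qed
  finally show ?thesis .
qed

lemma fourier_double_root_at_infinity:
  fixes f :: "'p::prime_card mod_ring poly poly"
  assumes two: "(2::'p mod_ring) \<noteq> 0" and three: "(3::'p mod_ring) \<noteq> 0"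
  shows "(\<Sum>h\<in>V. (if double_root_at_infinity h then 1 else 0) * add_char (pairing h f)) =
    (if cube_root_at_infinity f then of_nat CARD('p)^3 else 0)"
proof -
  note [simp] = numerals_neq_zero[OF two three] two three
  let ?g = "\<lambda>(a2, a3, a4). quartic 0 0 a2 a3 a4 :: 'p mod_ring poly poly"
  have set: "{h \<in> V. double_root_at_infinity h} = ?g ` UNIV"
  proof (intro equalityI subsetI)
    fix h :: "'p mod_ring poly poly" assume h: "h \<in> {h \<in> V. double_root_at_infinity h}"
    then have "h = ?g (qcoeff h 2, qcoeff h 3, qcoeff h 4)"
      using quartic_in_V by (intro V_eqI) (auto simp: double_root_at_infinity_def)
    then show "h \<in> ?g ` UNIV" by blast
  qed (auto simp: double_root_at_infinity_def quartic_in_V)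
  have inj: "inj ?g"
  proof (rule injI)
    fix u v assume "?g u = ?g v"
    then have "qcoeff (?g u) i = qcoeff (?g v) i" for i by simp
    from this[of 2] this[of 3] this[of 4] show "u = v" by (cases u, cases v) simp
  qed
  have "(\<Sum>h\<in>V. (if double_root_at_infinity h then 1 else 0) * add_char (pairing h f)) = (\<Sum>h\<in>{h \<in> V. double_root_at_infinity h}. add_char (pairing h f))"
    by (auto intro!: sum.cong simp: sum.inter_filter[OF finite_V])
  also have "\<dots> = (\<Sum>v\<in>UNIV. add_char (pairing (?g v) f))"
    unfolding set by (subst sum.reindex[OF inj]) simp
  also have "\<dots> = (\<Sum>(a2, a3, a4)\<in>UNIV. add_char (a2 * (qcoeff f 2 / 6) + a3 * (qcoeff f 3 / 4) + a4 * qcoeff f 4))"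
    by (rule sum.cong[OF refl]) (clarify, simp add: pairing_def)
  also have "\<dots> = (if cube_root_at_infinity f then of_nat CARD('p)^3 else 0)"
    unfolding sum_linear_add_char by (simp add: cube_root_at_infinity_def)
  finally show ?thesis .
qed

text \<open>The sum over all quadratic forms is the ternary sum of the discriminant form.\<close>
lemma sum_qchar_disc:
  assumes two: "(2::'a::{field,finite}) \<noteq> 0"
  shows "(\<Sum>\<gamma>\<in>UNIV. \<Sum>\<beta>\<in>UNIV. \<Sum>\<alpha>\<in>UNIV. qchar (\<beta>^2 - 4 * \<alpha> * \<gamma> :: 'a)) = int CARD('a) * (int CARD('a) - 1)"
proof -
  have "- ternary_det 0 0 (- 2) 1 0 0 = (2 :: 'a)^2" by (simp add: ternary_det_def)
  then have "ternary_sum 0 0 (- 2) 1 0 (0 :: 'a) = int CARD('a) * (int CARD('a) - 1)"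
    using ternary_sum_hyperbolic[OF two, of 0 "- 2" 1 0 0] two by (simp only: qchar_square[OF two]) simp
  then show ?thesis by (simp add: ternary_sum_def ternary_def)
qed

text \<open>
  Exchanging the sums, each pair \<open>(c, Q)\<close> with \<open>c \<noteq> 0\<close> contributes
  \<open>\<chi>(disc Q) e(c A(Q) / 12)\<close>. The sum over \<open>c\<close> is
  \<open>p - 1\<close> if \<open>A(Q) = 0\<close> and \<open>- 1\<close> otherwise.
\<close>
lemma fourier_square_multiple_sum:
  fixes f :: "'p::prime_card mod_ring poly poly"
  assumes two: "(2::'p mod_ring) \<noteq> 0" and three: "(3::'p mod_ring) \<noteq> 0"
  shows "(\<Sum>h\<in>V. of_int (square_multiple_sum h) * add_char (pairing h f)) =
    of_nat CARD('p) * of_int (apolar_sum f) - of_nat CARD('p) * (of_nat CARD('p) - 1)"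
proof -
  note [simp] = numerals_neq_zero[OF two three] two three
  let ?T = "{(c, \<alpha>, \<beta>, \<gamma>). c \<noteq> (0::'p mod_ring)} :: ('p mod_ring \<times> 'p mod_ring \<times> 'p mod_ring \<times> 'p mod_ring) set"
  let ?sq = "\<lambda>h (c, \<alpha>, \<beta>, \<gamma>). square_multiple h c \<alpha> \<beta> (\<gamma> :: 'p mod_ring)"
  let ?q = "\<lambda>(c, \<alpha>, \<beta>, \<gamma>). quartic (c * \<alpha>^2) (c * (2 * \<alpha> * \<beta>)) (c * (\<beta>^2 + 2 * \<alpha> * \<gamma>)) (c * (2 * \<beta> * \<gamma>)) (c * (\<gamma> :: 'p mod_ring)^2)"
  let ?w = "\<lambda>(c, \<alpha>, \<beta>, \<gamma>). of_int (qchar (\<beta>^2 - 4 * \<alpha> * \<gamma> :: 'p mod_ring)) :: complex"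
  have fibre: "{h \<in> V. ?sq h v} = {?q v}" for v
  proof -
    obtain c \<alpha> \<beta> \<gamma> where v: "v = (c, \<alpha>, \<beta>, \<gamma>)" by (cases v)
    have "square_multiple (?q v) c \<alpha> \<beta> \<gamma>" by (simp add: v square_multiple_def)
    moreover have "h = ?q v" if "h \<in> V" "square_multiple h c \<alpha> \<beta> \<gamma>" for h
      using that quartic_in_V by (intro V_eqI) (auto simp: square_multiple_def v)
    ultimately show ?thesis using quartic_in_V by (auto simp: v)
  qed
  have pair: "pairing (?q (c, \<alpha>, \<beta>, \<gamma>)) f = c * (catalecticant f \<alpha> \<beta> \<gamma> / 12)" for c \<alpha> \<beta> \<gamma>
  proof -
    have "12 * pairing (?q (c, \<alpha>, \<beta>, \<gamma>)) f = c * catalecticant f \<alpha> \<beta> \<gamma>"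
      by (simp add: twelve_pairing[OF two three] catalecticant_def algebra_simps)
    then show ?thesis by (simp add: nonzero_eq_divide_eq mult.commute)
  qed
  have inner: "(\<Sum>c\<in>UNIV - {0}. of_int n * add_char (c * (k / 12))) =
      of_int (int CARD('p) * (if k = 0 then n else 0) - n)" for n and k :: "'p mod_ring"
    by (simp only: sum_distrib_left[symmetric] sum_nonzero_add_char) (simp add: algebra_simps)
  have "(\<Sum>h\<in>V. of_int (square_multiple_sum h) * add_char (pairing h f))
      = (\<Sum>h\<in>V. \<Sum>v\<in>{v \<in> ?T. ?sq h v}. ?w v * add_char (pairing h f))"
  proof (rule sum.cong[OF refl])
    fix h :: "'p mod_ring poly poly"
    have "{v \<in> ?T. ?sq h v} = {(c, \<alpha>, \<beta>, \<gamma>). c \<noteq> 0 \<and> square_multiple h c \<alpha> \<beta> \<gamma>}" by auto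
    then show "of_int (square_multiple_sum h) * add_char (pairing h f) = (\<Sum>v\<in>{v \<in> ?T. ?sq h v}. ?w v * add_char (pairing h f))"
      by (simp add: square_multiple_sum_def sum_distrib_right case_prod_unfold)
  qed
  also have "\<dots> = (\<Sum>v\<in>?T. \<Sum>h\<in>{h \<in> V. ?sq h v}. ?w v * add_char (pairing h f))"
    by (rule sum.swap_restrict) (simp_all add: finite_V)
  also have "\<dots> = (\<Sum>v\<in>?T. ?w v * add_char (pairing (?q v) f))"
    by (simp only: fibre) simp
  also have "?T = (UNIV - {0}) \<times> UNIV \<times> UNIV \<times> UNIV" by auto
  also have "(\<Sum>v\<in>\<dots>. ?w v * add_char (pairing (?q v) f)) = (\<Sum>c\<in>UNIV-{0}. \<Sum>\<alpha>\<in>UNIV. \<Sum>\<beta>\<in>UNIV. \<Sum>\<gamma>\<in>UNIV.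
      of_int (qchar (\<beta>^2 - 4 * \<alpha> * \<gamma>)) * add_char (c * (catalecticant f \<alpha> \<beta> \<gamma> / 12)))"
    by (simp only: sum.cartesian_product' prod.case pair[unfolded prod.case])
  also have "\<dots> = (\<Sum>\<alpha>\<in>UNIV. \<Sum>\<beta>\<in>UNIV. \<Sum>\<gamma>\<in>UNIV. \<Sum>c\<in>UNIV-{0}.
      of_int (qchar (\<beta>^2 - 4 * \<alpha> * \<gamma>)) * add_char (c * (catalecticant f \<alpha> \<beta> \<gamma> / 12)))"
    by (rule sum_swap_to_inner)
  also have "\<dots> = (\<Sum>\<gamma>\<in>UNIV. \<Sum>\<beta>\<in>UNIV. \<Sum>\<alpha>\<in>UNIV. \<Sum>c\<in>UNIV-{0}.
      of_int (qchar (\<beta>^2 - 4 * \<alpha> * \<gamma>)) * add_char (c * (catalecticant f \<alpha> \<beta> \<gamma> / 12)))"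
    by (rule sum_reverse3)
  also have "\<dots> = (\<Sum>\<gamma>\<in>UNIV. \<Sum>\<beta>\<in>UNIV. \<Sum>\<alpha>\<in>UNIV. of_int
      (int CARD('p) * (if catalecticant f \<alpha> \<beta> \<gamma> = 0 then qchar (\<beta>^2 - 4 * \<alpha> * \<gamma>) else 0) - qchar (\<beta>^2 - 4 * \<alpha> * \<gamma>)))"
    by (simp only: inner)
  also have "\<dots> = of_int (int CARD('p) * apolar_sum f - int CARD('p) * (int CARD('p) - 1))"
    unfolding of_int_sum[symmetric]
    using sum_qchar_disc[OF two] by (simp add: sum_subtractf sum_distrib_left[symmetric] apolar_sum_def)
  finally show ?thesis by simp
qed

lemma fourier_singular:
  fixes f :: "'p::prime_card mod_ring poly poly"
  assumes two: "(2::'p mod_ring) \<noteq> 0" and three: "(3::'p mod_ring) \<noteq> 0"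
  shows "(of_nat CARD('p) - 1) * of_nat CARD('p)^4 * Phi_hat f =
    of_int ((int CARD('p) - 1) * int CARD('p)^2 * cube_root_count f - apolar_sum f)"
proof -
  let ?p = "of_nat CARD('p) :: complex" and ?e = "\<lambda>h. add_char (pairing h f)"
  have p: "?p \<noteq> 0" by simp
  have linear: "(\<Sum>h\<in>A. (c * d h - s h - z h) * e h) = c * (\<Sum>h\<in>A. d h * e h) - (\<Sum>h\<in>A. s h * e h) - (\<Sum>h\<in>A. z h * e h)"
    for A :: "'p mod_ring poly poly set" and c :: complex and d s z e
    by (simp add: left_diff_distrib sum_subtractf sum_distrib_left mult.assoc)
  have of_int_indicator: "of_int (if P then 1 else 0) = (if P then 1 else 0 :: complex)" for P by simp
  have indicator: "(if P then ?p^3 else 0) = ?p^3 * (if P then 1 else 0)" for P by simp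
  have "(\<Sum>h\<in>V. of_int (double_root_count h) * ?e h) =
      (\<Sum>h\<in>V. \<Sum>x\<in>UNIV. (if double_root h x then 1 else 0) * ?e h)
      + (\<Sum>h\<in>V. (if double_root_at_infinity h then 1 else 0) * ?e h)"
    by (simp only: double_root_count_def of_int_add of_int_sum of_int_indicator distrib_right sum.distrib sum_distrib_right)
  also have "(\<Sum>h\<in>V. \<Sum>x\<in>UNIV. (if double_root h x then 1 else 0) * ?e h)
      = (\<Sum>x\<in>UNIV. \<Sum>h\<in>V. (if double_root h x then 1 else 0) * ?e h)" by (rule sum.swap)
  also have "\<dots> + (\<Sum>h\<in>V. (if double_root_at_infinity h then 1 else 0) * ?e h) = ?p^3 * of_int (cube_root_count f)"
    unfolding fourier_double_root[OF two three] fourier_double_root_at_infinity[OF two three]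
    by (simp only: cube_root_count_def of_int_add of_int_sum of_int_indicator indicator distrib_left sum_distrib_left)
  finally have D: "(\<Sum>h\<in>V. of_int (double_root_count h) * ?e h) = ?p^3 * of_int (cube_root_count f)" .
  have "(if h = 0 then ?p * (?p - 1) else 0) * ?e h = (if h = 0 then ?p * (?p - 1) else 0)" for h
    by (simp add: pairing_def)
  then have Z: "(\<Sum>h\<in>V. (if h = 0 then ?p * (?p - 1) else 0) * ?e h) = ?p * (?p - 1)"
    by (simp only: sum.delta[OF finite_V] zero_in_V if_True)
  have Phi: "(?p - 1) * Phi h = (?p - 1) * of_int (double_root_count h) - of_int (square_multiple_sum h)
      - (if h = 0 then ?p * (?p - 1) else 0)" if "h \<in> V" for h :: "'p mod_ring poly poly"
  proof -
    have "of_int ((int CARD('p) - 1) * (if Disc h = 0 then 1 else 0)) = (of_int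
      ((int CARD('p) - 1) * double_root_count h - square_multiple_sum h
        - (if h = 0 then int CARD('p) * (int CARD('p) - 1) else 0)) :: complex)"
      using singular_indicator[OF two three, of h] unfolding V_eq_0_iff[OF that]
        by (simp only: CARD_mod_ring)
    then show ?thesis by (cases "Disc h = 0"; cases "h = 0") (simp_all add: Phi_def)
  qed
  have "(?p - 1) * (\<Sum>h\<in>V. Phi h * ?e h) = (\<Sum>h\<in>V. ((?p - 1) * Phi h) * ?e h)"
    by (subst sum_distrib_left, rule sum.cong[OF refl], rule mult.assoc[symmetric])
  also have "\<dots> = (\<Sum>h\<in>V. ((?p - 1) * of_int (double_root_count h)
      - of_int (square_multiple_sum h) - (if h = 0 then ?p * (?p - 1) else 0)) * ?e h)"
    by (rule sum.cong[OF refl]) (simp only: Phi)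
  also have "\<dots> = (?p - 1) * (\<Sum>h\<in>V. of_int (double_root_count h) * ?e h)
      - (\<Sum>h\<in>V. of_int (square_multiple_sum h) * ?e h) - (\<Sum>h\<in>V. (if h = 0 then ?p * (?p - 1) else 0) * ?e h)"
    by (rule linear)
  also have "\<dots> = ?p * of_int ((int CARD('p) - 1) * int CARD('p)^2 * cube_root_count f - apolar_sum f)"
  proof -
    have alg: "(q - 1) * (q^3 * c) - (q * a - q * (q - 1)) - q * (q - 1) = q * ((q - 1) * q^2 * c - a)"
      for q c a :: complex
      by (simp add: algebra_simps power2_eq_square power3_eq_cube)
    show ?thesis
      unfolding D Z fourier_square_multiple_sum[OF two three] alg by simp
  qed
  finally have total: "(?p - 1) * (\<Sum>h\<in>V. Phi h * ?e h)
      = ?p * of_int ((int CARD('p) - 1) * int CARD('p)^2 * cube_root_count f - apolar_sum f)" .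
  have "?p * ((?p - 1) * ?p^4 * Phi_hat f) = (?p - 1) * (?p^5 * Phi_hat f)"
    by (simp add: eval_nat_numeral)
  also have "?p^5 * Phi_hat f = (\<Sum>h\<in>V. Phi h * ?e h)"
    using p by (simp add: Phi_hat_def)
  finally have "?p * ((?p - 1) * ?p^4 * Phi_hat f)
      = ?p * of_int ((int CARD('p) - 1) * int CARD('p)^2 * cube_root_count f - apolar_sum f)"
    by (simp only: total)
  then show ?thesis using p by (simp only: mult_cancel_left simp_thms)
qed

section \<open>Evaluation of the cubic character sum\<close>

lemma sum_resolvent_cusp:
  fixes f :: "'a::{field,finite} poly poly"
  assumes "I_inv f = 0" "J_inv f = 0"
  shows "(\<Sum>w\<in>UNIV. qchar (resolvent f w)) = int CARD('a)"
  using assms by (simp add: resolvent_def)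

lemma sum_resolvent_J_zero:
  fixes f :: "'a::{field,finite} poly poly"
  assumes two: "(2::'a) \<noteq> 0" and three: "(3::'a) \<noteq> 0" and "J_inv f = 0" "I_inv f \<noteq> 0"
  shows "(\<Sum>w\<in>UNIV. qchar (resolvent f w)) = - qchar (- 3 * I_inv f)"
  using sum_qchar_quadratic[OF two, of "- 3 * I_inv f" 0 1] assms
  by (simp add: resolvent_def)

text \<open>
  With \<open>I = r\<^sup>2\<close>, \<open>J = 2 r\<^sup>3\<close> the cubic is
  \<open>(1 - r w)\<^sup>2 (1 + 2 r w)\<close>. So the sum is the vanishing sum over
  \<open>1 + 2 u\<close> without the term at the double root \<open>u = 1\<close>.
\<close>
lemma sum_resolvent_singular:
  fixes f :: "'a::{field,finite} poly poly"
  assumes two: "(2::'a) \<noteq> 0" and three: "(3::'a) \<noteq> 0" and D: "Disc f = 0" and I: "I_inv f \<noteq> 0"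
  shows "(\<Sum>w\<in>UNIV. qchar (resolvent f w)) = - qchar (3::'a)"
proof -
  obtain r where r: "I_inv f = r^2" "J_inv f = 2 * r^3"
    using cusp_param_if_Disc_eq_0[OF two three D] .
  have r0: "r \<noteq> 0" using I r by auto
  have "resolvent f w = (1 - (r * w + 0))^2 * (1 + 2 * (r * w + 0))" for w
    by (simp add: resolvent_def r algebra_simps power2_eq_square power3_eq_cube)
  then have "(\<Sum>w\<in>UNIV. qchar (resolvent f w)) = (\<Sum>u\<in>UNIV. qchar ((1 - u)^2 * (1 + 2 * u :: 'a)))"
    using sum_affine[OF r0, of "\<lambda>u. qchar ((1 - u)^2 * (1 + 2 * u))" 0] by simp
  also have "\<dots> = (\<Sum>u\<in>UNIV - {1}. qchar (1 + 2 * u :: 'a))"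
    by (subst sum.remove[of UNIV 1]) (auto intro!: sum.cong simp: qchar_mult_square)
  also have "\<dots> = (\<Sum>u\<in>UNIV. qchar (2 * u + 1 :: 'a)) - qchar (3::'a)"
    by (subst sum.remove[of UNIV 1]) (simp_all add: add.commute)
  finally show ?thesis by (simp add: sum_qchar_affine[OF two two])
qed

lemma card_E'_points:
  fixes f :: "'a::{field,finite} poly poly"
  assumes two: "(2::'a) \<noteq> 0"
  shows "int (card (E'_points f)) =
    int CARD('a) + 1 + (\<Sum>x\<in>UNIV. qchar (x^3 - 3 * I_inv f * x^2 + (J_inv f)^2))"
proof -
  let ?g = "\<lambda>x. x^3 - 3 * I_inv f * x^2 + (J_inv f)^2"
  have "{(x, y). y^2 = ?g x} = (SIGMA x:UNIV. {y. y^2 = ?g x})" by auto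
  then have "int (card {(x, y). y^2 = ?g x}) = (\<Sum>x\<in>UNIV. int (card {y. y^2 = ?g x}))"
    by simp
  also have "\<dots> = int CARD('a) + (\<Sum>x\<in>UNIV. qchar (?g x))"
    by (simp add: card_square_roots[OF two] sum.distrib)
  finally show ?thesis
    unfolding E'_points_def by (subst card_insert_disjoint) (auto simp: card_image)
qed

text \<open>
  For \<open>x = J w\<close> the right-hand side of the equation of \<open>E'\<^sub>f\<close> is
  \<open>J\<^sup>2\<close> times the resolvent cubic.
\<close>
lemma sum_resolvent_elliptic:
  fixes f :: "'p::prime_card mod_ring poly poly"
  assumes two: "(2::'p mod_ring) \<noteq> 0" and J: "J_inv f \<noteq> 0"
  shows "(\<Sum>w\<in>UNIV. qchar (resolvent f w)) = - a_E' f"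
proof -
  let ?g = "\<lambda>x. x^3 - 3 * I_inv f * x^2 + (J_inv f)^2"
  have "?g (J_inv f * w + 0) = (J_inv f)^2 * resolvent f w" for w
    by (simp add: resolvent_def algebra_simps power2_eq_square power3_eq_cube)
  then have "(\<Sum>w\<in>UNIV. qchar (resolvent f w)) = (\<Sum>x\<in>UNIV. qchar (?g x))"
    using sum_affine[OF J, of "\<lambda>x. qchar (?g x)" 0] by (simp only: qchar_mult_square[OF J])
  then show ?thesis by (simp add: a_E'_def card_E'_points[OF two])
qed

lemma to_int_mod_ring_of_int: "to_int_mod_ring (of_int k :: 'p::prime_card mod_ring) = k mod int CARD('p)"
  unfolding of_int_of_int_mod_ring by transfer simp

lemma of_int_mod_ring_eq_iff:
  "(of_int a :: 'p::prime_card mod_ring) = of_int b \<longleftrightarrow> [a = b] (mod int CARD('p))"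
  unfolding cong_def to_int_mod_ring_of_int[symmetric] by (metis of_int_mod_ring_to_int_mod_ring)

lemma of_int_to_int_mod_ring: "of_int (to_int_mod_ring x) = (x :: 'p::prime_card mod_ring)"
  by (simp add: of_int_of_int_mod_ring)

lemma Legendre_eq_qchar: "Legendre k (int CARD('p)) = qchar (of_int k :: 'p::prime_card mod_ring)"
proof -
  have "[k = 0] (mod int CARD('p)) \<longleftrightarrow> (of_int k :: 'p mod_ring) = 0"
    using of_int_mod_ring_eq_iff[of k 0, where 'p='p] by simp
  moreover have "QuadRes (int CARD('p)) k \<longleftrightarrow> (\<exists>y. (of_int k :: 'p mod_ring) = y^2)"
  proof
    assume "QuadRes (int CARD('p)) k"
    then obtain y where "[y^2 = k] (mod int CARD('p))" by (auto simp: QuadRes_def)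
    then have "(of_int (y^2) :: 'p mod_ring) = of_int k" by (simp only: of_int_mod_ring_eq_iff)
    then show "\<exists>y. (of_int k :: 'p mod_ring) = y^2" by (metis of_int_power)
  next
    assume "\<exists>y. (of_int k :: 'p mod_ring) = y^2"
    then obtain y :: "'p mod_ring" where "of_int k = y^2" ..
    then have "(of_int ((to_int_mod_ring y)^2) :: 'p mod_ring) = of_int k"
      by (simp add: of_int_to_int_mod_ring)
    then show "QuadRes (int CARD('p)) k" unfolding of_int_mod_ring_eq_iff QuadRes_def ..
  qed
  ultimately show ?thesis by (simp add: Legendre_def qchar_def)
qed

lemma legendre_symbol_eq_qchar: "legendre_symbol x = qchar x"
  by (simp add: legendre_symbol_def Legendre_eq_qchar of_int_to_int_mod_ring)

lemma Legendre_mod_3: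
  "Legendre p 3 = (if p mod 3 = 0 then 0 else if p mod 3 = 1 then 1 else - 1)"
proof -
  have sq: "y^2 mod 3 = 0 \<or> y^2 mod 3 = (1::int)" for y
  proof -
    have "y mod 3 = 0 \<or> y mod 3 = 1 \<or> y mod 3 = 2" by presburger
    moreover have "y^2 mod 3 = (y mod 3)^2 mod 3" by (simp add: power_mod)
    ultimately show ?thesis by auto
  qed
  have "QuadRes 3 p \<longleftrightarrow> p mod 3 \<in> {0, 1}"
  proof
    assume "QuadRes 3 p"
    then show "p mod 3 \<in> {0, 1}" using sq by (auto simp: QuadRes_def cong_def) metis
  next
    assume "p mod 3 \<in> {0, 1}"
    then have "[0^2 = p] (mod 3) \<or> [1^2 = p] (mod 3)" by (auto simp: cong_def)
    then show "QuadRes 3 p" unfolding QuadRes_def by blast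
  qed
  then show ?thesis by (auto simp: Legendre_def cong_def)
qed

lemma coprime_2_3_mod_12: "\<not> 2 dvd n \<Longrightarrow> \<not> 3 dvd n \<Longrightarrow> n mod 12 \<in> {1, 5, 7, 11 :: nat}"
  unfolding insert_iff empty_iff by presburger

lemma half_even_iff_mod_12:
  "n mod 12 \<in> {1, 5, 7, 11 :: nat} \<Longrightarrow> even ((n - 1) div 2) \<longleftrightarrow> n mod 12 \<in> {1, 5}"
  unfolding insert_iff empty_iff by presburger

text \<open>Quadratic reciprocity for the primes \<open>3\<close> and \<open>p\<close>.\<close>
lemma qchar_3:
  assumes p: "CARD('p::prime_card) > 3"
  shows "qchar (3 :: 'p mod_ring) = chi12 CARD('p)"
proof -
  let ?p = "CARD('p)"
  have prime: "prime ?p" by (rule prime_card)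
  have "\<not> 2 dvd ?p" "\<not> 3 dvd ?p"
    using prime p primes_dvd_imp_eq[of 2 ?p] primes_dvd_imp_eq[of 3 ?p] by auto
  then have cases: "?p mod 12 \<in> {1, 5, 7, 11}"
    using coprime_2_3_mod_12 by blast
  have "Legendre 3 (int ?p) * Legendre (int ?p) 3 = (- 1) ^ ((3 - 1) div 2 * ((?p - 1) div 2))"
    using Quadratic_Reciprocity[of 3 ?p] prime p by simp
  then have QR: "Legendre 3 (int ?p) * Legendre (int ?p) 3 = (- 1) ^ ((?p - 1) div 2)" by simp
  have mod3: "int ?p mod 3 = int (?p mod 12 mod 3)" by (simp add: mod_mod_cancel zmod_int)
  have "even ((?p - 1) div 2) \<longleftrightarrow> ?p mod 12 \<in> {1, 5}"
    using half_even_iff_mod_12[OF cases] .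
  then have "Legendre 3 (int ?p) = chi12 ?p"
    using cases QR by (auto simp: Legendre_mod_3 mod3 chi12_def)
  then show ?thesis using Legendre_eq_qchar[of 3, where 'p='p] by simp
qed

lemma two_three_neq_zero:
  assumes p: "CARD('p::prime_card) > 3"
  shows "(2 :: 'p mod_ring) \<noteq> 0" "(3 :: 'p mod_ring) \<noteq> 0"
proof -
  have "(of_int k :: 'p mod_ring) \<noteq> of_int 0" if "0 < k" "k \<le> 3" for k
    unfolding of_int_mod_ring_eq_iff cong_def using p that by simp
  from this[of 2] this[of 3] show "(2 :: 'p mod_ring) \<noteq> 0" "(3 :: 'p mod_ring) \<noteq> 0"
    by simp_all
qed

text \<open>A form with a triple factor is a nullform: all its invariants vanish.\<close>
lemma cube_root_invariants:
  assumes "cube_root f x"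
  shows "I_inv f = 0" "J_inv f = 0"
proof -
  have b: "qcoeff f 0 = x^3 * qcoeff f 3 - 3 * x^4 * qcoeff f 4"
    "qcoeff f 1 = 3 * x^2 * qcoeff f 3 - 8 * x^3 * qcoeff f 4"
    "qcoeff f 2 = 3 * x * qcoeff f 3 - 6 * x^2 * qcoeff f 4"
    using assms by (auto simp: cube_root_def)
  show "I_inv f = 0" unfolding I_inv_def b
    by (simp add: algebra_simps power2_eq_square power3_eq_cube power4_eq_xxxx)
  show "J_inv f = 0" unfolding J_inv_def b
    by (simp add: algebra_simps power2_eq_square power3_eq_cube power4_eq_xxxx)
qed

lemma cube_root_count_eq_0:
  fixes f :: "'a::{field,finite} poly poly"
  assumes "I_inv f \<noteq> 0 \<or> J_inv f \<noteq> 0"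
  shows "cube_root_count f = 0"
proof -
  have "\<not> cube_root f x" for x using assms cube_root_invariants by blast
  moreover have "\<not> cube_root_at_infinity f"
    using assms by (auto simp: cube_root_at_infinity_def I_inv_def J_inv_def)
  ultimately show ?thesis by (simp add: cube_root_count_def)
qed

text \<open>
  Together with the two evaluations of \<open>apolar_sum\<close>, this reduces every case to the cubic
  sum and the number of cubes dividing \<open>f\<close>.
\<close>
lemma Phi_hat_eq:
  fixes f :: "'p::prime_card mod_ring poly poly"
  assumes p: "CARD('p) > 3" and A: "apolar_sum f = (int CARD('p) - 1) * A"
  shows "Phi_hat f = of_int (cube_root_count f) / of_nat CARD('p)^2 - of_int A / of_nat CARD('p)^4"
proof -
  let ?p = "of_nat CARD('p) :: complex"
  have p1: "?p - 1 \<noteq> 0" using p by simp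
  have p0: "?p \<noteq> 0" by simp
  have "(?p - 1) * (?p^4 * Phi_hat f) = (?p - 1) * (?p^2 * of_int (cube_root_count f) - of_int A)"
  proof -
    have "(?p - 1) * (?p^4 * Phi_hat f)
        = of_int ((int CARD('p) - 1) * int CARD('p)^2 * cube_root_count f - (int CARD('p) - 1) * A)"
      using fourier_singular[OF two_three_neq_zero[OF p], of f] by (simp only: A mult.assoc)
    then show ?thesis by (simp add: right_diff_distrib mult.assoc)
  qed
  then have "?p^4 * Phi_hat f = ?p^2 * of_int (cube_root_count f) - of_int A"
    using p1 by (simp only: mult_cancel_left simp_thms)
  then have "Phi_hat f = (?p^2 * of_int (cube_root_count f) - of_int A) / ?p^4"
    using p0 by (simp add: nonzero_eq_divide_eq mult.commute)
  also have "\<dots> = of_int (cube_root_count f) / ?p^2 - of_int A / ?p^4"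
    by (simp add: diff_divide_distrib power2_eq_square power4_eq_xxxx)
  finally show ?thesis .
qed

section \<open>Splitting types in terms of coefficients\<close>

definition linear_form :: "'a::comm_ring_1 \<Rightarrow> 'a \<Rightarrow> 'a poly poly" where
  "linear_form s t = [:[:0, s:], [:t:]:]"

definition quadratic_form :: "'a::comm_ring_1 \<Rightarrow> 'a \<Rightarrow> 'a \<Rightarrow> 'a poly poly" where
  "quadratic_form \<alpha> \<beta> \<gamma> = [:[:0, 0, \<alpha>:], [:0, \<beta>:], [:\<gamma>:]:]"

lemma binary_form_1E:
  assumes "binary_form 1 g"
  obtains s t where "g = linear_form s t"
proof -
  have zero: "coeff (coeff g i) j = 0" if "i + j \<noteq> 1" for i j
    using assms that by (auto simp: binary_form_def)
  show thesis
  proof (rule that, intro poly_eqI)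
  fix i j
  show "coeff (coeff g i) j = coeff (coeff (linear_form (coeff (coeff g 0) 1) (coeff (coeff g 1) 0)) i) j"
    using zero unfolding linear_form_def
    by (auto simp: coeff_pCons split: nat.splits)
  qed
qed

lemma binary_form_2E:
  assumes "binary_form 2 g"
  obtains \<alpha> \<beta> \<gamma> where "g = quadratic_form \<alpha> \<beta> \<gamma>"
proof -
  have zero: "coeff (coeff g i) j = 0" if "i + j \<noteq> 2" for i j
    using assms that by (auto simp: binary_form_def)
  show thesis
  proof (rule that, intro poly_eqI)
  fix i j
  show "coeff (coeff g i) j = coeff (coeff (quadratic_form (coeff (coeff g 0) 2) (coeff (coeff g 1) 1) (coeff (coeff g 2) 0)) i) j"
    using zero unfolding quadratic_form_def
    by (auto simp: coeff_pCons numeral_2_eq_2 split: nat.splits)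
  qed
qed

lemma smult_linear_form: "smult [:c:] (linear_form s t) = linear_form (c * s) (c * t)"
  by (simp add: linear_form_def)

lemma smult_quadratic_form: "smult [:c:] (quadratic_form \<alpha> \<beta> \<gamma>) = quadratic_form (c * \<alpha>) (c * \<beta>) (c * \<gamma>)"
  by (simp add: quadratic_form_def)

lemma smult_quartic: "smult [:c:] (quartic a0 a1 a2 a3 a4) = quartic (c * a0) (c * a1) (c * a2) (c * a3) (c * a4)"
  by (simp add: quartic_def)

lemma linear_form_mult:
  "linear_form s t * linear_form s' t' = quadratic_form (s * s') (s * t' + t * s') (t * t')"
  by (simp add: linear_form_def quadratic_form_def algebra_simps)

lemma quadratic_form_mult:
  "quadratic_form \<alpha> \<beta> \<gamma> * quadratic_form \<alpha>' \<beta>' \<gamma>' =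
    quartic (\<alpha> * \<alpha>') (\<alpha> * \<beta>' + \<beta> * \<alpha>') (\<alpha> * \<gamma>' + \<beta> * \<beta>' + \<gamma> * \<alpha>') (\<beta> * \<gamma>' + \<gamma> * \<beta>') (\<gamma> * \<gamma>')"
  by (simp add: quadratic_form_def quartic_def algebra_simps)

lemma linear_form_eq_0_iff: "linear_form s t = 0 \<longleftrightarrow> s = 0 \<and> t = 0"
  by (simp add: linear_form_def)

text \<open>A linear form vanishes at the origin, and a unit does not.\<close>
lemma linear_form_not_unit: "\<not> linear_form s (t :: 'a::field) dvd 1"
proof
  assume "linear_form s t dvd 1"
  then have "poly (poly (linear_form s t) 0) 0 dvd (1 :: 'a)"
    by (metis dvd_def poly_mult poly_1)
  then show False by (simp add: linear_form_def)
qed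

lemma proportional_linear_form:
  fixes s t s' t' :: "'a::field"
  assumes "linear_form s t \<noteq> 0" "linear_form s' t' \<noteq> 0" "s * t' = s' * t"
  shows "proportional (linear_form s t) (linear_form s' t')"
proof (cases "s' = 0")
  case True
  then have t': "t' \<noteq> 0" and s: "s = 0" using assms by (auto simp: linear_form_eq_0_iff)
  then have "t \<noteq> 0" using assms by (auto simp: linear_form_eq_0_iff)
  then show ?thesis using True s t' unfolding proportional_def smult_linear_form
    by (intro exI[of _ "t / t'"]) simp
next
  case False
  then have "s \<noteq> 0" using assms by (auto simp: linear_form_eq_0_iff)
  then show ?thesis using False assms(3) unfolding proportional_def smult_linear_form
    by (intro exI[of _ "s / s'"]) (simp add: field_simps)
qed

text \<open>The quadratic formula; for \<open>\<alpha> = 0\<close> the form is divisible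
  by \<open>y\<close>.\<close>
lemma quadratic_form_factors:
  fixes \<alpha> \<beta> \<gamma> \<delta> :: "'a::field"
  assumes two: "(2::'a) \<noteq> 0" and D: "\<beta>^2 - 4 * \<alpha> * \<gamma> = \<delta>^2"
  obtains s t s' t' where "quadratic_form \<alpha> \<beta> \<gamma> = linear_form s t * linear_form s' t'"
proof (cases "\<alpha> = 0")
  case True
  then have "quadratic_form \<alpha> \<beta> \<gamma> = linear_form 0 1 * linear_form \<beta> \<gamma>"
    by (simp add: linear_form_mult)
  then show ?thesis by (rule that)
next
  case False
  have four: "(4::'a) \<noteq> 0" using two by (metis mult_2 mult_eq_0_iff numeral_Bit0)
  have "(\<beta> + \<delta>) * (\<beta> - \<delta>) = 4 * \<alpha> * \<gamma>" using D
    by (simp add: algebra_simps power2_eq_square)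
  moreover have "(2 * \<alpha>) * 2 = 4 * \<alpha>" by simp
  ultimately have "(\<beta> + \<delta>) / (2 * \<alpha>) * ((\<beta> - \<delta>) / 2) = \<gamma>"
    using False four by (simp only: times_divide_times_eq) simp
  moreover have "(\<beta> - \<delta>) / 2 + (\<beta> + \<delta>) / (2 * \<alpha>) * \<alpha> = \<beta>"
  proof -
    have "(\<beta> - \<delta>) / 2 + (\<beta> + \<delta>) / (2 * \<alpha>) * \<alpha> = (2 * \<beta>) / 2"
      using False two by (simp add: add_divide_distrib[symmetric])
    then show ?thesis using two by simp
  qed
  ultimately have "quadratic_form \<alpha> \<beta> \<gamma> = linear_form 1 ((\<beta> + \<delta>) / (2 * \<alpha>)) * linear_form \<alpha> ((\<beta> - \<delta>) / 2)"
    by (simp add: linear_form_mult)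
  then show ?thesis by (rule that)
qed

lemma irreducible_quadratic_form_disc:
  fixes \<alpha> \<beta> \<gamma> :: "'a::field"
  assumes two: "(2::'a) \<noteq> 0" and irr: "irreducible (quadratic_form \<alpha> \<beta> \<gamma>)"
  shows "\<nexists>\<delta>. \<beta>^2 - 4 * \<alpha> * \<gamma> = \<delta>^2"
proof
  assume "\<exists>\<delta>. \<beta>^2 - 4 * \<alpha> * \<gamma> = \<delta>^2"
  then obtain \<delta> where "\<beta>^2 - 4 * \<alpha> * \<gamma> = \<delta>^2" ..
  from quadratic_form_factors[OF two this] obtain s t s' t'
    where "quadratic_form \<alpha> \<beta> \<gamma> = linear_form s t * linear_form s' t'" .
  from irreducibleD[OF irr this] show False by (simp add: linear_form_not_unit)
qed

text \<open>Multiplying by \<open>4 \<alpha>\<close> or by \<open>4 \<gamma>\<close> completes the square.\<close>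
lemma disc_square_if_zero:
  fixes \<alpha> \<beta> \<gamma> x y :: "'a::field"
  assumes "\<alpha> * x^2 + \<beta> * x * y + \<gamma> * y^2 = 0" and "x \<noteq> 0 \<or> y \<noteq> 0"
  shows "\<exists>\<delta>. \<beta>^2 - 4 * \<alpha> * \<gamma> = \<delta>^2"
proof -
  have "(2 * \<alpha> * x + \<beta> * y)^2 = (\<beta>^2 - 4 * \<alpha> * \<gamma>) * y^2 + 4 * \<alpha> * (\<alpha> * x^2 + \<beta> * x * y + \<gamma> * y^2)"
    "(2 * \<gamma> * y + \<beta> * x)^2 = (\<beta>^2 - 4 * \<alpha> * \<gamma>) * x^2 + 4 * \<gamma> * (\<alpha> * x^2 + \<beta> * x * y + \<gamma> * y^2)"
    by (simp_all add: algebra_simps power2_eq_square)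
  then have sq: "(2 * \<alpha> * x + \<beta> * y)^2 = (\<beta>^2 - 4 * \<alpha> * \<gamma>) * y^2" "(2 * \<gamma> * y + \<beta> * x)^2 = (\<beta>^2 - 4 * \<alpha> * \<gamma>) * x^2"
    by (simp_all only: assms(1)) simp_all
  from assms(2) show ?thesis
  proof
    assume "x \<noteq> 0"
    then show ?thesis using sq(2) by (intro exI[of _ "(2 * \<gamma> * y + \<beta> * x) / x"]) (simp add: power_divide)
  next
    assume "y \<noteq> 0"
    then show ?thesis using sq(1) by (intro exI[of _ "(2 * \<alpha> * x + \<beta> * y) / y"]) (simp add: power_divide)
  qed
qed

lemma cube_root_unique:
  assumes two: "(2::'a::field) \<noteq> 0" and three: "(3::'a) \<noteq> 0"
    and x: "cube_root f x" and y: "cube_root f y" and "x \<noteq> (y :: 'a)" and f: "f \<in> V"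
  shows "f = 0"
proof -
  have nz: "x - y \<noteq> 0" using assms by simp
  let ?b = "qcoeff f"
  note xx = x[unfolded cube_root_def] and yy = y[unfolded cube_root_def]
  have "3 * (x - y) * (?b 3 - 2 * (x + y) * ?b 4)
      = (3 * x * ?b 3 - 6 * x^2 * ?b 4) - (3 * y * ?b 3 - 6 * y^2 * ?b 4)"
    by (simp add: algebra_simps power2_eq_square)
  also have "\<dots> = 0" using xx yy by simp
  finally have b3: "?b 3 = 2 * (x + y) * ?b 4" using nz three by simp
  have "- 2 * (x - y)^3 * ?b 4
      = (3 * x^2 * (2 * (x + y) * ?b 4) - 8 * x^3 * ?b 4) - (3 * y^2 * (2 * (x + y) * ?b 4) - 8 * y^3 * ?b 4)"
    by (simp add: algebra_simps power2_eq_square power3_eq_cube)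
  also have "\<dots> = 0" using xx yy unfolding b3 by simp
  finally have "?b 4 = 0" using nz two by simp
  with b3 xx show ?thesis
    by (intro V_eqI[OF f zero_in_V]) simp_all
qed

lemma cube_root_infinity_unique:
  assumes "cube_root f x" "cube_root_at_infinity f" "f \<in> V"
  shows "f = 0"
  using assms by (intro V_eqI[OF assms(3) zero_in_V]) (simp_all add: cube_root_def cube_root_at_infinity_def)

lemma triple_factor:
  fixes s t s' t' :: "'a::{field,finite}"
  assumes two: "(2::'a) \<noteq> 0" and three: "(3::'a) \<noteq> 0"
    and f: "f = linear_form s t ^ 3 * linear_form s' t'" and nz: "f \<noteq> 0"
  shows "cube_root_count f = 1" "I_inv f = 0" "J_inv f = 0"
proof -
  have "linear_form s t ^ 3 * linear_form s' t' = (linear_form s t * linear_form s t) * (linear_form s t * linear_form s' t')"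
    by (simp add: power3_eq_cube mult.assoc)
  then have f': "f = quartic (s * s * (s * s')) (s * s * (s * t' + t * s') + (s * t + t * s) * (s * s'))
      (s * s * (t * t') + (s * t + t * s) * (s * t' + t * s') + t * t * (s * s'))
      ((s * t + t * s) * (t * t') + t * t * (s * t' + t * s')) (t * t * (t * t'))"
    unfolding f linear_form_mult quadratic_form_mult by simp
  have st: "s \<noteq> 0 \<or> t \<noteq> 0" using nz f by (auto simp: linear_form_eq_0_iff)
  have V: "f \<in> V" unfolding f' by (rule quartic_in_V)
  show "cube_root_count f = 1"
  proof (cases "t = 0")
    case True
    have inf: "cube_root_at_infinity f" using True by (simp add: f' cube_root_at_infinity_def)
    then have "\<not> cube_root f x" for x using cube_root_infinity_unique[OF _ inf V] nz by blast
    then show ?thesis using inf by (simp add: cube_root_count_def)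
  next
    case False
    have "cube_root f (s / t)"
    proof -
      define x where "x = s / t"
      have s: "s = x * t" using False by (simp add: x_def)
      show ?thesis unfolding x_def[symmetric] cube_root_def f' s
        by (simp add: algebra_simps power2_eq_square power3_eq_cube power4_eq_xxxx)
    qed
    then have "cube_root f x \<longleftrightarrow> x = s / t" for x using cube_root_unique[OF two three _ _ _ V] nz
      by blast
    moreover have "\<not> cube_root_at_infinity f"
      using cube_root_infinity_unique[OF \<open>cube_root f (s / t)\<close> _ V] nz by blast
    ultimately show ?thesis by (simp add: cube_root_count_def)
  qed
  show "I_inv f = 0" "J_inv f = 0"
    by (simp_all add: f' I_inv_def J_inv_def algebra_simps power2_eq_square power3_eq_cube)
qed

text \<open>
  Let \<open>R\<close> be the value of the cofactor \<open>q\<close> at the zero of the linear form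
  \<open>l\<close>. Then \<open>I = R\<^sup>2\<close> and \<open>J = - 2 R\<^sup>3\<close>. The
  covariant \<open>I Hess(f) - 6 J f\<close> is proportional to
  \<open>disc q R\<^sup>2 l\<^sup>4\<close>, while it vanishes for every
  \<open>c Q\<^sup>2\<close>. So \<open>f\<close> is not such a multiple of a square with
  \<open>c disc Q \<noteq> 0\<close>.
\<close>
lemma double_factor:
  fixes s t \<alpha> \<beta> \<gamma> :: "'a::field"
  assumes two: "(2::'a) \<noteq> 0" and three: "(3::'a) \<noteq> 0"
    and f: "f = linear_form s t ^ 2 * quadratic_form \<alpha> \<beta> \<gamma>"
    and D: "\<beta>^2 - 4 * \<alpha> * \<gamma> \<noteq> 0" and R: "\<alpha> * t^2 + \<beta> * t * (- s) + \<gamma> * (- s)^2 \<noteq> 0"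
  shows "Disc f = 0" "I_inv f \<noteq> 0" "square_multiple f c a b d \<Longrightarrow> c * (b^2 - 4 * a * d) = 0"
proof -
  let ?R = "\<alpha> * t^2 + \<beta> * t * (- s) + \<gamma> * (- s)^2" and ?D = "\<beta>^2 - 4 * \<alpha> * \<gamma>"
  have f': "f = quartic (s * s * \<alpha>) (s * s * \<beta> + (s * t + t * s) * \<alpha>)
      (s * s * \<gamma> + (s * t + t * s) * \<beta> + t * t * \<alpha>) ((s * t + t * s) * \<gamma> + t * t * \<beta>) (t * t * \<gamma>)"
    unfolding f power2_eq_square linear_form_mult quadratic_form_mult by simp
  have I: "I_inv f = ?R^2"
    by (simp add: f' I_inv_def algebra_simps power2_eq_square power3_eq_cube)
  have J: "J_inv f = - 2 * ?R^3"
    by (simp add: f' J_inv_def algebra_simps power2_eq_square power3_eq_cube)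
  show "Disc f = 0" by (rule Disc_eq_0_if_cusp_param[OF I J])
  show "I_inv f \<noteq> 0" using R by (simp only: I power_eq_0_iff simp_thms)
  assume sq: "square_multiple f c a b d"
  \<comment> \<open>For \<open>(i, j) = (0, 1)\<close> and \<open>(4, 3)\<close> these are, up to a common
    factor, the outer coefficients of the covariant.\<close>
  let ?H = "\<lambda>i j. I_inv f * (8 * qcoeff f i * qcoeff f 2 - 3 * qcoeff f j ^ 2) - 2 * J_inv f * qcoeff f i"
  have "?H 0 1 = 0"
    unfolding I_inv_square_multiple[OF sq] J_inv_square_multiple[OF sq]
    using sq by (simp add: square_multiple_def algebra_simps power2_eq_square power3_eq_cube)
  moreover have "?H 0 1 = - 3 * ?D * ?R^2 * s^4"
    unfolding I J by (simp add: f' algebra_simps power2_eq_square power3_eq_cube power4_eq_xxxx)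
  ultimately have "s = 0" using D R three by (simp only: mult_eq_0_iff power_eq_0_iff neg_equal_0_iff_equal) simp
  have "?H 4 3 = 0"
    unfolding I_inv_square_multiple[OF sq] J_inv_square_multiple[OF sq]
    using sq by (simp add: square_multiple_def algebra_simps power2_eq_square power3_eq_cube)
  moreover have "?H 4 3 = - 3 * ?D * ?R^2 * t^4"
    unfolding I J by (simp add: f' algebra_simps power2_eq_square power3_eq_cube power4_eq_xxxx)
  ultimately have "t = 0" using D R three by (simp only: mult_eq_0_iff power_eq_0_iff neg_equal_0_iff_equal) simp
  with \<open>s = 0\<close> R show "c * (b^2 - 4 * a * d) = 0" by simp
qed

lemma square_multiple_quadratic_form:
  "f = smult [:c:] (quadratic_form \<alpha> \<beta> \<gamma> ^ 2) \<Longrightarrow> square_multiple f c \<alpha> \<beta> \<gamma>"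
  unfolding power2_eq_square quadratic_form_mult smult_quartic square_multiple_def
  by (simp add: algebra_simps)

lemma splitting_type_oneE:
  assumes "has_splitting_type f [(d, e)]"
  obtains c g where "c \<noteq> 0" "binary_form d g" "irreducible g" "f = smult [:c:] (g ^ e)"
proof -
  from assms obtain c gs where c: "c \<noteq> 0" and l: "length gs = 1"
    and g: "binary_form d (gs ! 0)" "irreducible (gs ! 0)" and f: "f = smult [:c:] ((gs ! 0) ^ e)"
    unfolding has_splitting_type_def by (auto simp: lessThan_Suc)
  then show thesis by (intro that)
qed

lemma splitting_type_twoE:
  assumes "has_splitting_type f [(d, e), (d', e')]"
  obtains c g g' where "c \<noteq> 0" "binary_form d g" "irreducible g" "binary_form d' g'" "irreducible g'"
    "\<not> proportional g g'" "f = smult [:c:] (g ^ e * g' ^ e')"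
proof -
  let ?t = "[(d, e), (d', e')]"
  from assms obtain c gs where c: "c \<noteq> 0" "f = smult [:c:] (\<Prod>i < length ?t. (gs ! i) ^ snd (?t ! i))"
    and g: "\<And>i. i < length ?t \<Longrightarrow> binary_form (fst (?t ! i)) (gs ! i) \<and> irreducible (gs ! i)"
    and np: "\<And>i j. i < length ?t \<Longrightarrow> j < length ?t \<Longrightarrow> i \<noteq> j \<Longrightarrow> \<not> proportional (gs ! i) (gs ! j)"
    unfolding has_splitting_type_def by blast
  show thesis
    by (rule that[of c "gs ! 0" "gs ! 1"])
      (use c g[of 0] g[of 1] np[of 0 1] in \<open>simp_all add: lessThan_Suc mult.commute\<close>)
qed

lemma splitting_type_threeE:
  assumes "has_splitting_type f [(d, e), (d', e'), (d'', e'')]"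
  obtains c g g' g'' where "c \<noteq> 0" "binary_form d g" "irreducible g" "binary_form d' g'" "irreducible g'"
    "binary_form d'' g''" "irreducible g''"
    "\<not> proportional g g'" "\<not> proportional g g''" "\<not> proportional g' g''"
    "f = smult [:c:] (g ^ e * g' ^ e' * g'' ^ e'')"
proof -
  let ?t = "[(d, e), (d', e'), (d'', e'')]"
  from assms obtain c gs where c: "c \<noteq> 0" "f = smult [:c:] (\<Prod>i < length ?t. (gs ! i) ^ snd (?t ! i))"
    and g: "\<And>i. i < length ?t \<Longrightarrow> binary_form (fst (?t ! i)) (gs ! i) \<and> irreducible (gs ! i)"
    and np: "\<And>i j. i < length ?t \<Longrightarrow> j < length ?t \<Longrightarrow> i \<noteq> j \<Longrightarrow> \<not> proportional (gs ! i) (gs ! j)"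
    unfolding has_splitting_type_def by blast
  show thesis
    by (rule that[of c "gs ! 0" "gs ! 1" "gs ! 2"])
      (use c g[of 0] g[of 1] g[of 2] np[of 0 1] np[of 0 2] np[of 1 2] in \<open>simp_all add: lessThan_Suc mult_ac numeral_2_eq_2\<close>)
qed

section \<open>The values of the Fourier transform\<close>

lemma not_proportional_linear_forms:
  fixes s t s' t' :: "'a::field"
  assumes "irreducible (linear_form s t)" "irreducible (linear_form s' t')"
    and "\<not> proportional (linear_form s t) (linear_form s' t')"
  shows "s * t' - s' * t \<noteq> 0"
proof -
  have "linear_form s t \<noteq> 0" "linear_form s' t' \<noteq> 0"
    using assms(1,2) by (simp_all add: irreducible_def)
  then show ?thesis using proportional_linear_form assms(3) by auto
qed

lemma Phi_hat_zero:
  assumes p: "CARD('p::prime_card) > 3"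
  shows "Phi_hat (0 :: 'p mod_ring poly poly) = 1 / of_nat CARD('p) + 1 / of_nat CARD('p)^2 - 1 / of_nat CARD('p)^3"
proof -
  note nz = two_three_neq_zero[OF p]
  let ?f = "0 :: 'p mod_ring poly poly"
  have inv: "I_inv ?f = 0" "J_inv ?f = 0" by (simp_all add: I_inv_def J_inv_def)
  have A: "apolar_sum ?f = (int CARD('p) - 1) * int CARD('p)"
    using apolar_sum_non_square[OF nz, of ?f] I_inv_square_multiple[of ?f] inv
    by (auto simp: sum_resolvent_cusp)
  have "cube_root_count ?f = int CARD('p) + 1"
    by (simp add: cube_root_count_def cube_root_def cube_root_at_infinity_def)
  then show ?thesis
    using Phi_hat_eq[OF p A] by (simp add: add_divide_distrib eval_nat_numeral)
qed

lemma Phi_hat_triple_factor: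
  fixes f :: "'p::prime_card mod_ring poly poly"
  assumes p: "CARD('p) > 3" and f: "f = linear_form s t ^ 3 * linear_form s' t'" and "f \<noteq> 0"
  shows "Phi_hat f = 1 / of_nat CARD('p)^2 - 1 / of_nat CARD('p)^3"
proof -
  note nz = two_three_neq_zero[OF p]
  note triple = triple_factor[OF nz f \<open>f \<noteq> 0\<close>]
  have "apolar_sum f = (int CARD('p) - 1) * int CARD('p)"
    using apolar_sum_non_square[OF nz, of f] I_inv_square_multiple[of f] triple
    by (auto simp: sum_resolvent_cusp)
  from Phi_hat_eq[OF p this] triple(1) show ?thesis
    by (simp add: eval_nat_numeral)
qed

text \<open>
  This covers \<open>(1\<^sup>2 1 1)\<close> and \<open>(1\<^sup>2 2)\<close>: the cofactor of the
  double root is nondegenerate and prime to it.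
\<close>
lemma Phi_hat_double_factor:
  fixes f :: "'p::prime_card mod_ring poly poly"
  assumes p: "CARD('p) > 3" and f: "f = linear_form s t ^ 2 * quadratic_form \<alpha> \<beta> \<gamma>"
    and D: "\<beta>^2 - 4 * \<alpha> * \<gamma> \<noteq> 0" and R: "\<alpha> * t^2 + \<beta> * t * (- s) + \<gamma> * (- s)^2 \<noteq> 0"
  shows "Phi_hat f = of_int (chi12 CARD('p)) * (1 / of_nat CARD('p)^4)"
proof -
  note nz = two_three_neq_zero[OF p]
  note double = double_factor[OF nz f D R]
  have "apolar_sum f = (int CARD('p) - 1) * (- chi12 CARD('p))"
    using apolar_sum_non_square[OF nz, of f, OF double(3)] sum_resolvent_singular[OF nz double(1,2)]
    by (simp add: qchar_3[OF p])
  from Phi_hat_eq[OF p this] double(2) show ?thesis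
    by (simp add: cube_root_count_eq_0)
qed

text \<open>
  This covers \<open>(1\<^sup>2 1\<^sup>2)\<close>, where the discriminant is a square, and
  \<open>(2\<^sup>2)\<close>, where it is not.
\<close>
lemma Phi_hat_square:
  fixes f :: "'p::prime_card mod_ring poly poly"
  assumes p: "CARD('p) > 3" and f: "f = smult [:c:] (quadratic_form \<alpha> \<beta> \<gamma> ^ 2)"
    and D: "c \<noteq> 0" "\<beta>^2 - 4 * \<alpha> * \<gamma> \<noteq> 0"
  shows "Phi_hat f = of_int (chi12 CARD('p)) *
    (- of_int (qchar (\<beta>^2 - 4 * \<alpha> * \<gamma>)) / of_nat CARD('p)^3 + 1 / of_nat CARD('p)^4)"
proof -
  let ?D = "\<beta>^2 - 4 * \<alpha> * \<gamma>"
  note nz = two_three_neq_zero[OF p]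
  note sq = square_multiple_quadratic_form[OF f]
  have I: "I_inv f \<noteq> 0" using I_inv_square_multiple[OF sq] D by simp
  have cD: "c * ?D \<noteq> 0" using D by simp
  have "apolar_sum f = (int CARD('p) - 1) * (chi12 CARD('p) * (int CARD('p) * qchar ?D - 1))"
    unfolding apolar_sum_square[OF nz sq cD] sum_resolvent_singular[OF nz Disc_square_multiple[OF sq] I]
      qchar_mult[OF nz(1)] qchar_3[OF p]
    by (simp add: algebra_simps)
  from Phi_hat_eq[OF p this] I show ?thesis
    by (simp add: cube_root_count_eq_0 right_diff_distrib distrib_left diff_divide_distrib eval_nat_numeral)
qed

lemma Phi_hat_J_zero:
  fixes f :: "'p::prime_card mod_ring poly poly"
  assumes p: "CARD('p) > 3" and J: "J_inv f = 0" and I: "I_inv f \<noteq> 0"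
  shows "Phi_hat f = of_int (legendre_symbol (- 3 * I_inv f)) * (1 / of_nat CARD('p)^4)"
proof -
  note nz = two_three_neq_zero[OF p]
  have "c * (\<beta>^2 - 4 * \<alpha> * \<gamma>) = 0" if "square_multiple f c \<alpha> \<beta> \<gamma>" for c \<alpha> \<beta> \<gamma>
    using J_inv_square_multiple[OF that] J nz(1) by auto
  from apolar_sum_non_square[OF nz this]
  have "apolar_sum f = (int CARD('p) - 1) * (- qchar (- 3 * I_inv f))"
    using sum_resolvent_J_zero[OF nz J I] by simp
  from Phi_hat_eq[OF p this] I show ?thesis
    by (simp add: cube_root_count_eq_0 legendre_symbol_eq_qchar)
qed

lemma Phi_hat_elliptic:
  fixes f :: "'p::prime_card mod_ring poly poly"
  assumes p: "CARD('p) > 3" and J: "J_inv f \<noteq> 0" and D: "Disc f \<noteq> 0"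
  shows "Phi_hat f = of_int (a_E' f) * (1 / of_nat CARD('p)^4)"
proof -
  note nz = two_three_neq_zero[OF p]
  have "c * (\<beta>^2 - 4 * \<alpha> * \<gamma>) = 0" if "square_multiple f c \<alpha> \<beta> \<gamma>" for c \<alpha> \<beta> \<gamma>
    using Disc_square_multiple[OF that] D by blast
  from apolar_sum_non_square[OF nz this]
  have "apolar_sum f = (int CARD('p) - 1) * (- a_E' f)"
    using sum_resolvent_elliptic[OF nz(1) J] by simp
  from Phi_hat_eq[OF p this] J show ?thesis
    by (simp add: cube_root_count_eq_0)
qed

lemma Phi_hat_split_1_4:
  fixes f :: "'p::prime_card mod_ring poly poly"
  assumes p: "CARD('p) > 3" and f: "has_splitting_type f [(1, 4)]"
  shows "Phi_hat f = 1 / of_nat CARD('p)^2 - 1 / of_nat CARD('p)^3"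
proof -
  from splitting_type_oneE[OF f] obtain c g where c: "c \<noteq> 0" and g: "binary_form 1 g" "irreducible g"
    and fg: "f = smult [:c:] (g ^ 4)" .
  from binary_form_1E[OF g(1)] obtain s t where st: "g = linear_form s t" .
  have "f = linear_form s t ^ 3 * linear_form (c * s) (c * t)"
    by (simp add: fg st smult_linear_form[symmetric] eval_nat_numeral mult_ac)
  moreover have "f \<noteq> 0" using c g(2) by (auto simp: fg irreducible_def)
  ultimately show ?thesis by (rule Phi_hat_triple_factor[OF p])
qed

lemma Phi_hat_split_1_3_1:
  fixes f :: "'p::prime_card mod_ring poly poly"
  assumes p: "CARD('p) > 3" and f: "has_splitting_type f [(1, 3), (1, 1)]"
  shows "Phi_hat f = 1 / of_nat CARD('p)^2 - 1 / of_nat CARD('p)^3"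
proof -
  from splitting_type_twoE[OF f] obtain c g g' where c: "c \<noteq> 0" and g: "binary_form 1 g" "irreducible g"
    and g': "binary_form 1 g'" "irreducible g'" and fg: "f = smult [:c:] (g ^ 3 * g' ^ 1)" .
  from binary_form_1E[OF g(1)] obtain s t where st: "g = linear_form s t" .
  from binary_form_1E[OF g'(1)] obtain s' t' where st': "g' = linear_form s' t'" .
  have "f = linear_form s t ^ 3 * linear_form (c * s') (c * t')"
    by (simp add: fg st st' smult_linear_form[symmetric])
  moreover have "f \<noteq> 0" using c g(2) g'(2) by (auto simp: fg irreducible_def)
  ultimately show ?thesis by (rule Phi_hat_triple_factor[OF p])
qed

lemma Phi_hat_split_1_2_1_2:
  fixes f :: "'p::prime_card mod_ring poly poly"
  assumes p: "CARD('p) > 3" and f: "has_splitting_type f [(1, 2), (1, 2)]"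
  shows "Phi_hat f = of_int (chi12 CARD('p)) * (- 1 / of_nat CARD('p)^3 + 1 / of_nat CARD('p)^4)"
proof -
  from splitting_type_twoE[OF f] obtain c g g' where c: "c \<noteq> 0" and g: "binary_form 1 g" "irreducible g"
    and g': "binary_form 1 g'" "irreducible g'" and np: "\<not> proportional g g'"
    and fg: "f = smult [:c:] (g ^ 2 * g' ^ 2)" .
  from binary_form_1E[OF g(1)] obtain s t where st: "g = linear_form s t" .
  from binary_form_1E[OF g'(1)] obtain s' t' where st': "g' = linear_form s' t'" .
  have nz: "s * t' - s' * t \<noteq> 0"
    using g(2) g'(2) np unfolding st st' by (rule not_proportional_linear_forms)
  have "f = smult [:c:] (quadratic_form (s * s') (s * t' + t * s') (t * t') ^ 2)"
    by (simp add: fg st st' linear_form_mult[symmetric] power_mult_distrib)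
  moreover have disc: "(s * t' + t * s')^2 - 4 * (s * s') * (t * t') = (s * t' - s' * t)^2"
    by (simp add: algebra_simps power2_eq_square)
  ultimately show ?thesis
    using Phi_hat_square[OF p, of f c "s * s'" "s * t' + t * s'" "t * t'"] c nz
    unfolding disc by (simp add: qchar_square)
qed

lemma Phi_hat_split_2_2:
  fixes f :: "'p::prime_card mod_ring poly poly"
  assumes p: "CARD('p) > 3" and f: "has_splitting_type f [(2, 2)]"
  shows "Phi_hat f = of_int (chi12 CARD('p)) * (1 / of_nat CARD('p)^3 + 1 / of_nat CARD('p)^4)"
proof -
  from splitting_type_oneE[OF f] obtain c g where c: "c \<noteq> 0" and g: "binary_form 2 g" "irreducible g"
    and fg: "f = smult [:c:] (g ^ 2)" .
  from binary_form_2E[OF g(1)] obtain \<alpha> \<beta> \<gamma> where q: "g = quadratic_form \<alpha> \<beta> \<gamma>" .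
  note ns = irreducible_quadratic_form_disc[OF two_three_neq_zero(1)[OF p] g(2)[unfolded q]]
  then have nz: "\<beta>^2 - 4 * \<alpha> * \<gamma> \<noteq> 0" by (metis power_zero_numeral)
  with ns have "qchar (\<beta>^2 - 4 * \<alpha> * \<gamma>) = - 1" by (simp add: qchar_def)
  then show ?thesis using Phi_hat_square[OF p fg[unfolded q] c nz] by simp
qed

lemma Phi_hat_split_1_2_1_1:
  fixes f :: "'p::prime_card mod_ring poly poly"
  assumes p: "CARD('p) > 3" and f: "has_splitting_type f [(1, 2), (1, 1), (1, 1)]"
  shows "Phi_hat f = of_int (chi12 CARD('p)) * (1 / of_nat CARD('p)^4)"
proof -
  from splitting_type_threeE[OF f] obtain c g g' g'' where c: "c \<noteq> 0" and g: "binary_form 1 g" "irreducible g"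
    and g': "binary_form 1 g'" "irreducible g'" and g'': "binary_form 1 g''" "irreducible g''"
    and np: "\<not> proportional g g'" "\<not> proportional g g''" "\<not> proportional g' g''"
    and fg: "f = smult [:c:] (g ^ 2 * g' ^ 1 * g'' ^ 1)" .
  from binary_form_1E[OF g(1)] obtain s t where st: "g = linear_form s t" .
  from binary_form_1E[OF g'(1)] obtain s' t' where st': "g' = linear_form s' t'" .
  from binary_form_1E[OF g''(1)] obtain s'' t'' where st'': "g'' = linear_form s'' t''" .
  have nz: "s * t' - s' * t \<noteq> 0" "s * t'' - s'' * t \<noteq> 0" "s' * t'' - s'' * t' \<noteq> 0"
    by (rule not_proportional_linear_forms; use g(2) g'(2) g''(2) np st st' st'' in simp)+
  have fq: "f = linear_form s t ^ 2 * quadratic_form (c * (s' * s'')) (c * (s' * t'' + t' * s'')) (c * (t' * t''))"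
    by (simp add: fg st st' st'' linear_form_mult[symmetric] smult_quadratic_form[symmetric] mult.assoc)
  have disc: "(c * (s' * t'' + t' * s''))^2 - 4 * (c * (s' * s'')) * (c * (t' * t'')) = (c * (s' * t'' - s'' * t'))^2"
    by (simp add: algebra_simps power2_eq_square)
  have res: "c * (s' * s'') * t^2 + c * (s' * t'' + t' * s'') * t * (- s) + c * (t' * t'') * (- s)^2
      = c * (s * t' - s' * t) * (s * t'' - s'' * t)"
    by (simp add: algebra_simps power2_eq_square)
  show ?thesis
    by (rule Phi_hat_double_factor[OF p fq]) (unfold disc res, use c nz in simp_all)
qed

lemma Phi_hat_split_1_2_2:
  fixes f :: "'p::prime_card mod_ring poly poly"
  assumes p: "CARD('p) > 3" and f: "has_splitting_type f [(1, 2), (2, 1)]"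
  shows "Phi_hat f = of_int (chi12 CARD('p)) * (1 / of_nat CARD('p)^4)"
proof -
  from splitting_type_twoE[OF f] obtain c g g' where c: "c \<noteq> 0" and g: "binary_form 1 g" "irreducible g"
    and g': "binary_form 2 g'" "irreducible g'" and fg: "f = smult [:c:] (g ^ 2 * g' ^ 1)" .
  from binary_form_1E[OF g(1)] obtain s t where st: "g = linear_form s t" .
  from binary_form_2E[OF g'(1)] obtain \<alpha> \<beta> \<gamma> where q: "g' = quadratic_form \<alpha> \<beta> \<gamma>" .
  note ns = irreducible_quadratic_form_disc[OF two_three_neq_zero(1)[OF p] g'(2)[unfolded q]]
  then have D: "\<beta>^2 - 4 * \<alpha> * \<gamma> \<noteq> 0" by (metis power_zero_numeral)
  have "t \<noteq> 0 \<or> - s \<noteq> 0" using g(2) by (auto simp: st irreducible_def linear_form_eq_0_iff)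
  then have R: "\<alpha> * t^2 + \<beta> * t * (- s) + \<gamma> * (- s)^2 \<noteq> 0"
    using disc_square_if_zero[of \<alpha> t \<beta> "- s" \<gamma>] ns by blast
  have fq: "f = linear_form s t ^ 2 * quadratic_form (c * \<alpha>) (c * \<beta>) (c * \<gamma>)"
    by (simp add: fg st q smult_quadratic_form[symmetric])
  have disc: "(c * \<beta>)^2 - 4 * (c * \<alpha>) * (c * \<gamma>) = c^2 * (\<beta>^2 - 4 * \<alpha> * \<gamma>)"
    and res: "c * \<alpha> * t^2 + c * \<beta> * t * (- s) + c * \<gamma> * (- s)^2 = c * (\<alpha> * t^2 + \<beta> * t * (- s) + \<gamma> * (- s)^2)"
    by (simp_all add: algebra_simps power2_eq_square)
  show ?thesis
    by (rule Phi_hat_double_factor[OF p fq]; unfold disc res)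
      (intro no_zero_divisors power_not_zero c D R)+
qed

theorem theorem1p1:
  fixes f :: "'p::prime_card mod_ring poly poly" and p :: nat
  assumes "p = CARD('p)" and "prime p" and "p > 3" and "f \<in> V"
  shows "(f = 0 \<longrightarrow>
           Phi_hat f = 1 / of_nat p + 1 / of_nat p ^ 2 - 1 / of_nat p ^ 3) \<and>
         (has_splitting_type f [(1, 4)] \<or> has_splitting_type f [(1, 3), (1, 1)] \<longrightarrow>
           Phi_hat f = 1 / of_nat p ^ 2 - 1 / of_nat p ^ 3) \<and>
         (has_splitting_type f [(1, 2), (1, 2)] \<longrightarrow>
           Phi_hat f = of_int (chi12 p) * (- 1 / of_nat p ^ 3 + 1 / of_nat p ^ 4)) \<and>
         (has_splitting_type f [(2, 2)] \<longrightarrow>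
           Phi_hat f = of_int (chi12 p) * (1 / of_nat p ^ 3 + 1 / of_nat p ^ 4)) \<and>
         (has_splitting_type f [(1, 2), (1, 1), (1, 1)] \<or> has_splitting_type f [(1, 2), (2, 1)] \<longrightarrow>
           Phi_hat f = of_int (chi12 p) * (1 / of_nat p ^ 4)) \<and>
         (J_inv f = 0 \<and> I_inv f \<noteq> 0 \<longrightarrow>
           Phi_hat f = of_int (legendre_symbol (- 3 * I_inv f)) * (1 / of_nat p ^ 4)) \<and>
         (J_inv f \<noteq> 0 \<and> Disc f \<noteq> 0 \<longrightarrow>
           Phi_hat f = of_int (a_E' f) * (1 / of_nat p ^ 4))"
proof -
  have p: "CARD('p) > 3" using assms by simp
  show ?thesis
    unfolding assms(1)
    using Phi_hat_zero[OF p] Phi_hat_split_1_4[OF p, of f] Phi_hat_split_1_3_1[OF p, of f]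
      Phi_hat_split_1_2_1_2[OF p, of f] Phi_hat_split_2_2[OF p, of f] Phi_hat_split_1_2_1_1[OF p, of f]
      Phi_hat_split_1_2_2[OF p, of f] Phi_hat_J_zero[OF p, of f] Phi_hat_elliptic[OF p, of f]
    by blast
qed

end
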